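(* Let $\phi=\frac{1+\sqrt5}{2}$. Then \[\lim_{g\to\infty}\frac{1}{g^4}\mathbb{E}_g[w(S)^2]=\left(\frac{1}{10\phi}\right)^2.\]
   Context: A numerical semigroup $S$ is a submonoid of $\mathbb{N}_0$ with finite complement $\mathcal{H}(S)$; its genus is $g=|\mathcal{H}(S)|$. The weight is $w(S)=\left(\sum_{x\in\mathcal{H}(S)}x\right)-\frac{g(g+1)}{2}$. $\mathcal{S}_g$ is the set of numerical semigroups of genus $g$ and $\mathbb{E}_g$ denotes expectation with respect to the uniform distribution on $\mathcal{S}_g$. *)

theory Defs
  imports Complex_Main
begin

definition numerical_semigroup :: "nat set \<Rightarrow> bool" where
  "numerical_semigroup S \<longleftrightarrow> 0 \<in> S \<and> (\<forall>x\<in>S. \<forall>y\<in>S. x + y \<in> S) \<and> finite (- S)"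

definition gaps :: "nat set \<Rightarrow> nat set" where
  "gaps S = - S"

definition genus :: "nat set \<Rightarrow> nat" where
  "genus S = card (gaps S)"

definition semigroups_of_genus :: "nat \<Rightarrow> nat set set" where
  "semigroups_of_genus g = {S. numerical_semigroup S \<and> genus S = g}"

definition weight :: "nat set \<Rightarrow> real" where
  "weight S = (\<Sum>x\<in>gaps S. real x) - real (genus S) * (real (genus S) + 1) / 2"

definition expect_g :: "nat \<Rightarrow> (nat set \<Rightarrow> real) \<Rightarrow> real" where
  "expect_g g f = (\<Sum>S\<in>semigroups_of_genus g. f S) / real (card (semigroups_of_genus g))"

definition golden_ratio :: real where
  "golden_ratio = (1 + sqrt 5) / 2"

end

theory Submission
  imports Defs "HOL-Number_Theory.Fib" "HOL-Real_Asymp.Real_Asymp"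
begin

text \<open>
  Since \<open>\<bar>weight S\<bar> \<le> 2 g\<^sup>2\<close>, it suffices that \<open>weight S / g\<^sup>2\<close> concentrates at \<open>1 / (10 \<phi>)\<close>.
  A semigroup of multiplicity \<open>m\<close> is encoded by its Kunz coordinates \<open>k\<^sub>1, \<dots>, k\<^bsub>m-1\<^esub>\<close>, whose sum is the
  genus. With \<open>\<xi> = 1 / \<phi>\<close> one has \<open>\<xi> + \<xi>\<^sup>2 = 1\<close>, so weighting a semigroup by \<open>\<xi>\<^bsup>g\<^esup>\<close> makes coordinates in
  \<open>{1, 2}\<close> independent random variables of total mass 1, whereas \<open>\<S>\<^sub>g\<close> has total weight at least \<open>\<xi>\<close>, because
  the semigroups with all coordinates in \<open>{1, 2}\<close> are counted by Fibonacci numbers. Hence any class of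
  exponentially small weight is negligible. Three classes are treated this way: multiplicity
  below \<open>g / 20\<close>; some coordinate \<open>\<ge> 4\<close>, or \<open>\<ge> 3\<close> at an index \<open>\<ge> \<epsilon> m\<close>; and, by a Chernoff bound,
  large deviations of \<open>\<Sum> k\<^sub>i\<close> or \<open>\<Sum> i k\<^sub>i\<close>. Outside them the weight is a polynomial in \<open>m\<close> and \<open>g\<close> up to
  small errors, and \<open>m / g\<close> is close to \<open>1 / (2 - \<xi>)\<close>.

  For the second class let \<open>q\<close> be the largest coordinate, \<open>c\<close> the last index where it occurs and \<open>a\<close> the
  first index of coordinate 1. The pairs \<open>(k\<^sub>i, k\<^bsub>c-i\<^esub>)\<close> have sum \<open>\<ge> q\<close>, the pairs \<open>(k\<^sub>i, k\<^bsub>m+c-i\<^esub>)\<close> with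
  \<open>i > c\<close> have sum \<open>\<ge> q - 1\<close> and entries below \<open>q\<close>, and \<open>k\<^bsub>i+a\<^esub> \<le> k\<^sub>i + 1\<close> links each pair to the one \<open>a\<close> steps
  further. The resulting transfer operator is a strict contraction for \<open>\<xi>\<close>-weights.
\<close>

section \<open>Kunz coordinates\<close>

definition mult :: "nat set \<Rightarrow> nat" where
  "mult S = (LEAST n. n \<in> S \<and> 0 < n)"

text \<open>The number of gaps congruent to \<open>i\<close>, for \<open>0 < i < mult S\<close>.\<close>

definition kunz :: "nat set \<Rightarrow> nat \<Rightarrow> nat" where
  "kunz S i = card {t. i + t * mult S \<notin> S}"

lemma finite_downset_eq_lessThan:
  fixes D :: "nat set"
  assumes "finite D" and "\<And>s t. t \<in> D \<Longrightarrow> s \<le> t \<Longrightarrow> s \<in> D"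
  shows "D = {..<card D}"
proof (cases "D = {}")
  case False
  then have "Max D \<in> D" using assms(1) by simp
  then have "t \<in> D \<longleftrightarrow> t < Suc (Max D)" for t
    using assms(2)[of "Max D" t] Max_ge[OF assms(1), of t] by (meson less_Suc_eq_le)
  then have "D = {..<Suc (Max D)}" by blast
  then show ?thesis by (metis card_lessThan)
qed simp

lemma mult_mem_pos:
  assumes "numerical_semigroup S"
  shows "mult S \<in> S" "0 < mult S"
proof -
  have "finite (- S)" using assms by (simp add: numerical_semigroup_def)
  then obtain b where b: "\<And>n. n \<in> - S \<Longrightarrow> n < b"
    using finite_nat_set_iff_bounded by auto
  then have "Suc b \<in> S \<and> 0 < Suc b" by fastforce
  then have "mult S \<in> S \<and> 0 < mult S" unfolding mult_def by (rule LeastI)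
  then show "mult S \<in> S" "0 < mult S" by auto
qed

lemma below_mult_notin: "0 < i \<Longrightarrow> i < mult S \<Longrightarrow> i \<notin> S"
  unfolding mult_def using not_less_Least by blast

lemma add_mult_mem:
  assumes "numerical_semigroup S" "x \<in> S"
  shows "x + t * mult S \<in> S"
proof (induction t)
  case (Suc t)
  then have "x + t * mult S + mult S \<in> S"
    using assms mult_mem_pos(1) by (auto simp: numerical_semigroup_def)
  then show ?case by (simp add: algebra_simps)
qed (use assms in simp)

text \<open>Adding \<open>mult S\<close> stays inside \<open>S\<close>, so the \<open>t\<close> with
  \<open>i + t * mult S\<close> outside \<open>S\<close> form an initial segment whose length is the
  threshold. The index \<open>i\<close> may exceed \<open>mult S\<close>, which lets
  \<open>kunz_add_le\<close> be stated without reducing index sums.\<close>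

lemma mem_iff_kunz_le:
  assumes S: "numerical_semigroup S"
  shows "i + t * mult S \<in> S \<longleftrightarrow> kunz S i \<le> t"
proof -
  let ?D = "{t. i + t * mult S \<notin> S}"
  have "finite (- S)" using S by (simp add: numerical_semigroup_def)
  then have fin: "finite ?D"
  proof (rule finite_imageD[OF finite_subset, of "\<lambda>t. i + t * mult S", rotated])
    show "inj_on (\<lambda>t. i + t * mult S) ?D"
      using mult_mem_pos(2)[OF S] by (auto simp: inj_on_def)
  qed auto
  have down: "s \<in> ?D" if "t \<in> ?D" "s \<le> t" for s t
  proof (rule ccontr)
    assume "s \<notin> ?D"
    then have "i + s * mult S + (t - s) * mult S \<in> S"
      using add_mult_mem[OF S] by blast
    moreover have "i + s * mult S + (t - s) * mult S = i + t * mult S"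
      using \<open>s \<le> t\<close> by (metis add.assoc add_mult_distrib le_add_diff_inverse)
    ultimately show False using that by simp
  qed
  have "?D = {..<kunz S i}"
    unfolding kunz_def by (rule finite_downset_eq_lessThan[OF fin down])
  then have "t \<in> ?D \<longleftrightarrow> t < kunz S i" by simp
  then show ?thesis by auto
qed

lemma kunz_pos:
  assumes "numerical_semigroup S" "0 < i" "i < mult S"
  shows "1 \<le> kunz S i"
  using mem_iff_kunz_le[OF assms(1), of i 0] below_mult_notin assms by fastforce

lemma kunz_add_le:
  assumes S: "numerical_semigroup S"
  shows "kunz S (i + j) \<le> kunz S i + kunz S j"
proof -
  have "i + kunz S i * mult S \<in> S" "j + kunz S j * mult S \<in> S"
    using mem_iff_kunz_le[OF S] by auto
  then have "(i + kunz S i * mult S) + (j + kunz S j * mult S) \<in> S"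
    using S unfolding numerical_semigroup_def by blast
  then have "(i + j) + (kunz S i + kunz S j) * mult S \<in> S"
    by (simp add: algebra_simps)
  then show ?thesis using mem_iff_kunz_le[OF S] by blast
qed

text \<open>Moving the index by \<open>mult S\<close> shifts the progression by one term. Combined
  with \<open>kunz_add_le\<close> this yields the Kunz inequality for index sums beyond
  \<open>mult S\<close>, with its extra 1.\<close>

lemma kunz_add_mult:
  assumes S: "numerical_semigroup S"
  shows "kunz S i \<le> kunz S (i + mult S) + 1"
proof -
  have "(i + mult S) + kunz S (i + mult S) * mult S \<in> S"
    using mem_iff_kunz_le[OF S] by blast
  then have "i + (kunz S (i + mult S) + 1) * mult S \<in> S"
    by (simp add: algebra_simps)
  then show ?thesis using mem_iff_kunz_le[OF S] by blast
qed

text \<open>All multiples of \<open>mult S\<close> lie in \<open>S\<close>, so residue 0 contributes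
  no gap; in any other class the gaps are the terms before the threshold.\<close>

lemma gaps_eq_kunz:
  assumes S: "numerical_semigroup S"
  shows "gaps S = (\<Union>i\<in>{1..<mult S}. (\<lambda>t. i + t * mult S) ` {..<kunz S i})"
proof (rule set_eqI)
  fix n
  let ?m = "mult S"
  have m: "0 < ?m" using mult_mem_pos[OF S] by simp
  have n: "n mod ?m + (n div ?m) * ?m = n" by simp
  show "n \<in> gaps S \<longleftrightarrow> n \<in> (\<Union>i\<in>{1..<mult S}. (\<lambda>t. i + t * mult S) ` {..<kunz S i})"
  proof
    assume "n \<in> gaps S"
    then have "n \<notin> S" by (simp add: gaps_def)
    then have lt: "n div ?m < kunz S (n mod ?m)"
      using mem_iff_kunz_le[OF S, of "n mod ?m" "n div ?m"] n by (metis not_le)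
    have "0 + (n div ?m) * ?m \<in> S"
      using S by (intro add_mult_mem) (simp_all add: numerical_semigroup_def)
    then have "n mod ?m \<noteq> 0" using \<open>n \<notin> S\<close> n by metis
    then have "n mod ?m \<in> {1..<?m}" using m by simp
    then show "n \<in> (\<Union>i\<in>{1..<mult S}. (\<lambda>t. i + t * mult S) ` {..<kunz S i})"
      using lt n by (metis (no_types, lifting) UN_I image_eqI lessThan_iff)
  next
    assume "n \<in> (\<Union>i\<in>{1..<mult S}. (\<lambda>t. i + t * mult S) ` {..<kunz S i})"
    then show "n \<in> gaps S" using mem_iff_kunz_le[OF S] by (auto simp: gaps_def)
  qed
qed

lemma sum_gaps_eq:
  fixes f :: "nat \<Rightarrow> 'a::comm_monoid_add"
  assumes S: "numerical_semigroup S"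
  shows "sum f (gaps S) = (\<Sum>i=1..<mult S. \<Sum>t<kunz S i. f (i + t * mult S))"
proof -
  have m: "0 < mult S" using mult_mem_pos[OF S] by simp
  have "sum f (gaps S) = (\<Sum>i=1..<mult S. sum f ((\<lambda>t. i + t * mult S) ` {..<kunz S i}))"
    unfolding gaps_eq_kunz[OF S]
  proof (rule sum.UNION_disjoint)
    show "\<forall>i\<in>{1..<mult S}. \<forall>j\<in>{1..<mult S}. i \<noteq> j \<longrightarrow>
      (\<lambda>t. i + t * mult S) ` {..<kunz S i} \<inter> (\<lambda>t. j + t * mult S) ` {..<kunz S j} = {}"
    proof (intro ballI impI)
      fix i j assume "i \<in> {1..<mult S}" "j \<in> {1..<mult S}" "i \<noteq> j"
      then have "i + s * mult S \<noteq> j + t * mult S" for s t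
        by (metis atLeastLessThan_iff mod_less mod_mult_self1)
      then show "(\<lambda>t. i + t * mult S) ` {..<kunz S i} \<inter> (\<lambda>t. j + t * mult S) ` {..<kunz S j} = {}"
        by auto
    qed
  qed auto
  also have "\<dots> = (\<Sum>i=1..<mult S. \<Sum>t<kunz S i. f (i + t * mult S))"
    using m by (intro sum.cong[OF refl]) (simp add: sum.reindex inj_on_def)
  finally show ?thesis .
qed

lemma sum_kunz:
  assumes S: "numerical_semigroup S"
  shows "(\<Sum>i=1..<mult S. kunz S i) = genus S"
  using sum_gaps_eq[OF S, of "\<lambda>_. 1 :: nat"] by (simp add: genus_def)

lemma kunz_le_genus:
  assumes S: "numerical_semigroup S"
  shows "kunz S i \<le> genus S"
  unfolding kunz_def genus_def
proof (rule card_inj_on_le)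
  show "inj_on (\<lambda>t. i + t * mult S) {t. i + t * mult S \<notin> S}"
    using mult_mem_pos(2)[OF S] by (auto simp: inj_on_def)
qed (use S in \<open>auto simp: gaps_def numerical_semigroup_def\<close>)

lemma mult_le_genus:
  assumes S: "numerical_semigroup S"
  shows "mult S \<le> genus S + 1"
proof -
  have "(\<Sum>i=1..<mult S. 1) \<le> (\<Sum>i=1..<mult S. kunz S i)"
    using kunz_pos[OF S] by (intro sum_mono) auto
  then show ?thesis using sum_kunz[OF S] by simp
qed

lemma kunz_inject:
  assumes S: "numerical_semigroup S" and T: "numerical_semigroup T"
    and "mult S = mult T" and "\<And>i. 1 \<le> i \<Longrightarrow> i < mult S \<Longrightarrow> kunz S i = kunz T i"
  shows "S = T"
proof -
  have "gaps S = gaps T"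
    unfolding gaps_eq_kunz[OF S] gaps_eq_kunz[OF T] using assms(3,4) by auto
  then show ?thesis by (auto simp: gaps_def)
qed

text \<open>If \<open>n\<close> is a gap, then \<open>i\<close> or \<open>n - i\<close> is a gap for
  each \<open>i\<close>, so the gaps and their reflections cover \<open>{..n}\<close>.\<close>

lemma gap_less_twice_genus:
  assumes S: "numerical_semigroup S" and "n \<in> gaps S"
  shows "n < 2 * genus S"
proof -
  have fin: "finite (gaps S)" using S by (simp add: gaps_def numerical_semigroup_def)
  have "i \<in> gaps S \<or> n - i \<in> gaps S" if "i \<le> n" for i
  proof (rule ccontr)
    assume "\<not> (i \<in> gaps S \<or> n - i \<in> gaps S)"
    then have "i + (n - i) \<in> S" using S unfolding numerical_semigroup_def gaps_def by blast
    then show False using that assms by (simp add: gaps_def)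
  qed
  then have "{..n} \<subseteq> gaps S \<union> (\<lambda>i. n - i) ` gaps S"
    by (smt (verit, best) UnCI atMost_iff diff_diff_cancel image_iff subsetI)
  then have "card {..n} \<le> card (gaps S \<union> (\<lambda>i. n - i) ` gaps S)"
    using fin by (intro card_mono) auto
  also have "\<dots> \<le> card (gaps S) + card ((\<lambda>i. n - i) ` gaps S)" by (rule card_Un_le)
  also have "\<dots> \<le> genus S + genus S"
    unfolding genus_def by (intro add_mono card_image_le fin order_refl)
  finally show ?thesis by simp
qed

lemma finite_semigroups_of_genus: "finite (semigroups_of_genus g)"
proof (rule finite_imageD[OF finite_subset])
  show "uminus ` semigroups_of_genus g \<subseteq> Pow {..<2 * g}"
    using gap_less_twice_genus by (fastforce simp: semigroups_of_genus_def gaps_def)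
qed (auto simp: inj_on_def)

lemma abs_weight_le:
  assumes "S \<in> semigroups_of_genus g"
  shows "\<bar>weight S\<bar> \<le> 2 * (real g)\<^sup>2"
proof -
  have S: "numerical_semigroup S" and g: "genus S = g"
    using assms by (auto simp: semigroups_of_genus_def)
  have "(\<Sum>x\<in>gaps S. real x) \<le> (\<Sum>x\<in>gaps S. 2 * real g)"
    using gap_less_twice_genus[OF S] g by (intro sum_mono) force
  also have "\<dots> = 2 * (real g)\<^sup>2" using g by (simp add: genus_def power2_eq_square)
  finally have "(\<Sum>x\<in>gaps S. real x) \<le> 2 * (real g)\<^sup>2" .
  moreover have "0 \<le> (\<Sum>x\<in>gaps S. real x)" by (simp add: sum_nonneg)
  moreover have "real g * (real g + 1) / 2 \<le> 2 * (real g)\<^sup>2"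
  proof (cases "g = 0")
    case False
    then have "real g * 1 \<le> real g * real g" by (intro mult_left_mono) auto
    then show ?thesis by (simp add: power2_eq_square algebra_simps)
  qed simp
  moreover have "0 \<le> real g * (real g + 1) / 2" by simp
  ultimately show ?thesis unfolding weight_def g by linarith
qed

section \<open>Weighted chains with a lag\<close>

text \<open>This describes \<open>a\<close> interleaved Markov chains: \<open>R\<close> links
  entries at distance \<open>a\<close>, and the first \<open>a\<close> entries are restricted by
  \<open>V\<close> alone. Ladders of Kunz coordinates have this shape, with \<open>a\<close> an
  index of coordinate 1.\<close>

definition chains :: "nat \<Rightarrow> (nat \<Rightarrow> 's set) \<Rightarrow> ('s \<Rightarrow> 's \<Rightarrow> bool) \<Rightarrow> nat \<Rightarrow> 's list set" where
  "chains a V R n = {xs. length xs = n \<and> (\<forall>j<n. xs ! j \<in> V j) \<and>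
     (\<forall>j<n. a \<le> j \<longrightarrow> R (xs ! (j - a)) (xs ! j))}"

lemma chains_0 [simp]: "chains a V R 0 = {[]}"
  by (auto simp: chains_def)

text \<open>Because \<open>0 < a\<close>, the entry with which the last one is compared already lies
  in the prefix.\<close>

lemma chains_Suc:
  assumes "0 < a"
  shows "chains a V R (Suc n) =
    (\<lambda>(xs, s). xs @ [s]) ` (SIGMA xs:chains a V R n. {s \<in> V n. a \<le> n \<longrightarrow> R (xs ! (n - a)) s})"
    (is "_ = ?f ` ?X")
proof (intro equalityI subsetI)
  fix ys assume ys: "ys \<in> chains a V R (Suc n)"
  then have len: "length ys = Suc n" by (simp add: chains_def)
  define xs s where "xs = take n ys" and "s = ys ! n"
  have eq: "ys = xs @ [s]"
    using len by (simp add: xs_def s_def take_Suc_conv_app_nth[symmetric])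
  have nth: "xs ! j = ys ! j" if "j < n" for j using that by (simp add: xs_def)
  have "xs \<in> chains a V R n"
    using ys len nth by (auto simp: chains_def xs_def)
  moreover have "s \<in> V n" "a \<le> n \<longrightarrow> R (xs ! (n - a)) s"
    using ys nth assms by (auto simp: chains_def s_def)
  ultimately show "ys \<in> ?f ` ?X" using eq by force
next
  fix ys assume "ys \<in> ?f ` ?X"
  then obtain xs s where xs: "xs \<in> chains a V R n" and s: "s \<in> V n" "a \<le> n \<longrightarrow> R (xs ! (n - a)) s"
    and ys: "ys = xs @ [s]" by auto
  have len: "length xs = n" using xs by (simp add: chains_def)
  have "ys ! j \<in> V j" if "j < Suc n" for j
    using that xs s len by (cases "j = n") (auto simp: ys nth_append chains_def)
  moreover have "R (ys ! (j - a)) (ys ! j)" if "j < Suc n" "a \<le> j" for j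
    using that xs s len assms by (cases "j = n") (auto simp: ys nth_append chains_def)
  ultimately show "ys \<in> chains a V R (Suc n)" using len by (simp add: chains_def ys)
qed

lemma finite_chains:
  assumes "0 < a" "\<And>j. finite (V j)"
  shows "finite (chains a V R n)"
proof (induction n)
  case (Suc n)
  then show ?case unfolding chains_Suc[OF assms(1)]
    by (intro finite_imageI finite_SigmaI) (auto simp: assms)
qed simp

lemma sum_chains_Suc:
  assumes "0 < a" "\<And>j. finite (V j)"
  shows "sum F (chains a V R (Suc n)) =
    (\<Sum>xs\<in>chains a V R n. \<Sum>s | s \<in> V n \<and> (a \<le> n \<longrightarrow> R (xs ! (n - a)) s). F (xs @ [s]))"
proof -
  have "sum F (chains a V R (Suc n)) =
      (\<Sum>(xs, s)\<in>(SIGMA xs:chains a V R n. {s \<in> V n. a \<le> n \<longrightarrow> R (xs ! (n - a)) s}). F (xs @ [s]))"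
    unfolding chains_Suc[OF assms(1)]
    by (subst sum.reindex) (auto simp: inj_on_def intro!: sum.cong)
  also have "\<dots> = (\<Sum>xs\<in>chains a V R n. \<Sum>s\<in>{s \<in> V n. a \<le> n \<longrightarrow> R (xs ! (n - a)) s}. F (xs @ [s]))"
    using assms by (intro sum.Sigma[symmetric] finite_chains ballI) auto
  finally show ?thesis .
qed

text \<open>Only the last \<open>a\<close> entries of a chain influence its extensions, so the transfer operator
  acts on one entry at a time: the potential of the entry that leaves the window
  pays for the entry that is appended.\<close>

lemma sum_chains_le:
  fixes w p :: "nat \<Rightarrow> 's \<Rightarrow> real" and \<beta> :: "nat \<Rightarrow> real"
  assumes a: "0 < a" and fin: "\<And>j. finite (V j)"
    and w: "\<And>j s. s \<in> V j \<Longrightarrow> 0 \<le> w j s" and p: "\<And>j s. s \<in> V j \<Longrightarrow> 0 \<le> p j s"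
    and \<beta>: "\<And>j. j < N \<Longrightarrow> 0 \<le> \<beta> j"
    and start: "\<And>j. j < N \<Longrightarrow> j < a \<Longrightarrow> (\<Sum>s\<in>V j. w j s * p j s) \<le> \<beta> j"
    and step: "\<And>j r. j < N \<Longrightarrow> a \<le> j \<Longrightarrow> r \<in> V (j - a) \<Longrightarrow>
      (\<Sum>s | s \<in> V j \<and> R r s. w j s * p j s) \<le> \<beta> j * p (j - a) r"
    and stop: "\<And>j s. j < N \<Longrightarrow> N \<le> j + a \<Longrightarrow> s \<in> V j \<Longrightarrow> 1 \<le> p j s"
  shows "(\<Sum>xs\<in>chains a V R N. \<Prod>j<N. w j (xs ! j)) \<le> (\<Prod>j<N. \<beta> j)"
proof -
  \<comment> \<open>\<open>?P\<close> runs over the window of the last \<open>a\<close> entries; by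
    truncated subtraction this is the whole list while \<open>n < a\<close>.\<close>
  let ?W = "\<lambda>n xs. \<Prod>j<n. w j (xs ! j)" and ?P = "\<lambda>n xs. \<Prod>j=n-a..<n. p j (xs ! j)"
  have main: "(\<Sum>xs\<in>chains a V R n. ?W n xs * ?P n xs) \<le> (\<Prod>j<n. \<beta> j)" if "n \<le> N" for n
    using that
  proof (induction n)
    case (Suc n)
    let ?X = "\<lambda>xs. {s. s \<in> V n \<and> (a \<le> n \<longrightarrow> R (xs ! (n - a)) s)}"
    have one: "(\<Sum>s\<in>?X xs. ?W (Suc n) (xs @ [s]) * ?P (Suc n) (xs @ [s])) \<le> \<beta> n * (?W n xs * ?P n xs)"
      if xs: "xs \<in> chains a V R n" for xs
    proof -
      have len: "length xs = n" and V: "\<And>j. j < n \<Longrightarrow> xs ! j \<in> V j"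
        using xs by (auto simp: chains_def)
      have W: "?W (Suc n) (xs @ [s]) = ?W n xs * w n s" for s
        using len by (auto simp: nth_append intro!: prod.cong)
      have "{Suc n - a..<Suc n} = insert n {Suc n - a..<n}" using a by auto
      then have P: "?P (Suc n) (xs @ [s]) = (\<Prod>j=Suc n-a..<n. p j (xs ! j)) * p n s" for s
        using len by (auto simp: nth_append intro!: prod.cong)
      have W0: "0 \<le> ?W n xs" using w V by (intro prod_nonneg) auto
      have P0: "0 \<le> (\<Prod>j=Suc n-a..<n. p j (xs ! j))" using p V by (intro prod_nonneg) auto
      have "(\<Sum>s\<in>?X xs. ?W (Suc n) (xs @ [s]) * ?P (Suc n) (xs @ [s])) =
          ?W n xs * (\<Prod>j=Suc n-a..<n. p j (xs ! j)) * (\<Sum>s\<in>?X xs. w n s * p n s)"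
        unfolding W P by (simp add: sum_distrib_left mult_ac)
      also have "\<dots> \<le> \<beta> n * (?W n xs * ?P n xs)"
      proof (cases "a \<le> n")
        case True
        have "{n - a..<n} = insert (n - a) {Suc n - a..<n}" using True a by auto
        then have split: "?P n xs = p (n - a) (xs ! (n - a)) * (\<Prod>j=Suc n-a..<n. p j (xs ! j))"
          using True a by (simp add: Suc_diff_le)
        have "(\<Sum>s\<in>?X xs. w n s * p n s) \<le> \<beta> n * p (n - a) (xs ! (n - a))"
          using step[of n "xs ! (n - a)"] True V[of "n - a"] Suc.prems a by simp
        then have "?W n xs * (\<Prod>j=Suc n-a..<n. p j (xs ! j)) * (\<Sum>s\<in>?X xs. w n s * p n s) \<le>
            ?W n xs * (\<Prod>j=Suc n-a..<n. p j (xs ! j)) * (\<beta> n * p (n - a) (xs ! (n - a)))"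
          using W0 P0 by (intro mult_left_mono) auto
        then show ?thesis by (simp add: split mult_ac)
      next
        case False
        \<comment> \<open>The window is not yet full: no entry leaves it, and \<open>start\<close>
          alone bounds the new factor.\<close>
        then have "(\<Sum>s\<in>?X xs. w n s * p n s) \<le> \<beta> n" using start[of n] Suc.prems by simp
        then have "?W n xs * (\<Prod>j=Suc n-a..<n. p j (xs ! j)) * (\<Sum>s\<in>?X xs. w n s * p n s) \<le>
            ?W n xs * (\<Prod>j=Suc n-a..<n. p j (xs ! j)) * \<beta> n"
          using W0 P0 by (intro mult_left_mono) auto
        moreover have "Suc n - a = 0" "n - a = 0" using False by auto
        ultimately show ?thesis by (simp only:) (simp add: mult_ac)
      qed
      finally show ?thesis .
    qed
    have "(\<Sum>xs\<in>chains a V R (Suc n). ?W (Suc n) xs * ?P (Suc n) xs) \<le>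
        (\<Sum>xs\<in>chains a V R n. \<beta> n * (?W n xs * ?P n xs))"
      unfolding sum_chains_Suc[OF a fin] using one by (rule sum_mono)
    also have "\<dots> = \<beta> n * (\<Sum>xs\<in>chains a V R n. ?W n xs * ?P n xs)"
      by (simp add: sum_distrib_left)
    also have "\<dots> \<le> \<beta> n * (\<Prod>j<n. \<beta> j)"
      using Suc \<beta>[of n] by (intro mult_left_mono) auto
    finally show ?case by (simp add: mult.commute)
  qed simp
  \<comment> \<open>By \<open>stop\<close> all potentials in the final window are at least 1, so
    inserting \<open>?P\<close> only increases the sum.\<close>
  have "(\<Sum>xs\<in>chains a V R N. ?W N xs) \<le> (\<Sum>xs\<in>chains a V R N. ?W N xs * ?P N xs)"
  proof (rule sum_mono)
    fix xs assume "xs \<in> chains a V R N"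
    then have V: "\<And>j. j < N \<Longrightarrow> xs ! j \<in> V j" by (simp add: chains_def)
    have "1 \<le> ?P N xs" using stop V by (intro prod_ge_1) auto
    moreover have "0 \<le> ?W N xs" using w V by (intro prod_nonneg) auto
    ultimately show "?W N xs \<le> ?W N xs * ?P N xs" by (simp add: mult_le_cancel_left1)
  qed
  also have "\<dots> \<le> (\<Prod>j<N. \<beta> j)" using main[of N] by simp
  finally show ?thesis .
qed

text \<open>A lag exceeding the length imposes no relation between the entries.\<close>

lemma sum_lists_prod_le:
  fixes w :: "nat \<Rightarrow> 's \<Rightarrow> real"
  assumes "\<And>j. finite (V j)" "\<And>j s. s \<in> V j \<Longrightarrow> 0 \<le> w j s"
    and "\<And>j. j < N \<Longrightarrow> (\<Sum>s\<in>V j. w j s) \<le> \<beta> j"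
  shows "(\<Sum>xs | length xs = N \<and> (\<forall>j<N. xs ! j \<in> V j). \<Prod>j<N. w j (xs ! j)) \<le> (\<Prod>j<N. \<beta> j)"
proof -
  have \<beta>: "0 \<le> \<beta> j" if "j < N" for j
    using assms(3)[OF that] sum_nonneg[of "V j" "w j"] assms(2) by force
  have "{xs. length xs = N \<and> (\<forall>j<N. xs ! j \<in> V j)} = chains (Suc N) V (\<lambda>_ _. True) N"
    by (auto simp: chains_def)
  moreover have "(\<Sum>xs\<in>chains (Suc N) V (\<lambda>_ _. True) N. \<Prod>j<N. w j (xs ! j)) \<le> (\<Prod>j<N. \<beta> j)"
    by (rule sum_chains_le[where p = "\<lambda>_ _. 1"]) (use assms \<beta> in auto)
  ultimately show ?thesis by simp
qed

section \<open>Contraction constants\<close>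

definition \<xi> :: real where "\<xi> = (sqrt 5 - 1) / 2"

lemma \<xi>_square: "\<xi>\<^sup>2 = 1 - \<xi>"
  by (simp add: \<xi>_def power2_eq_square field_simps)

lemma \<xi>_bounds: "61803 / 100000 < \<xi>" "\<xi> < 61804 / 100000"
proof -
  have "223606 / 100000 < sqrt 5" by (rule real_less_rsqrt) (simp add: power2_eq_square)
  then show "61803 / 100000 < \<xi>" by (simp add: \<xi>_def)
  have "sqrt 5 < 223608 / 100000" by (rule real_less_lsqrt) (simp_all add: power2_eq_square)
  then show "\<xi> < 61804 / 100000" by (simp add: \<xi>_def)
qed

lemma \<xi>_pos [simp]: "0 < \<xi>" and \<xi>_less_1 [simp]: "\<xi> < 1"
  using \<xi>_bounds by linarith+

lemma \<xi>_power_add_2: "\<xi> ^ (n + 2) = \<xi> ^ n - \<xi> ^ (n + 1)"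
proof -
  have "\<xi> ^ (n + 2) = \<xi> ^ n * \<xi>\<^sup>2" by (rule power_add)
  also have "\<dots> = \<xi> ^ n * (1 - \<xi>)" by (simp only: \<xi>_square)
  also have "\<dots> = \<xi> ^ n - \<xi> ^ (n + 1)" by (simp add: algebra_simps)
  finally show ?thesis .
qed

lemma \<xi>_cube: "\<xi> ^ 3 = 2 * \<xi> - 1"
proof -
  have "\<xi> ^ 3 = \<xi> * \<xi>\<^sup>2" by (simp add: eval_nat_numeral)
  also have "\<dots> = \<xi> * (1 - \<xi>)" by (simp only: \<xi>_square)
  also have "\<dots> = \<xi> - \<xi>\<^sup>2" by (simp add: right_diff_distrib power2_eq_square)
  finally show ?thesis by (simp add: \<xi>_square)
qed

text \<open>Powers of \<xi> are linear in \<xi> with Fibonacci coefficients. The explicit rung sums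
  below thus become linear in \<xi> and are settled by \<open>\<xi>_bounds\<close>.\<close>

lemma \<xi>_powers:
  "\<xi> ^ 4 = 2 - 3 * \<xi>" "\<xi> ^ 5 = 5 * \<xi> - 3"
  "\<xi> ^ 6 = 5 - 8 * \<xi>" "\<xi> ^ 7 = 13 * \<xi> - 8" "\<xi> ^ 8 = 13 - 21 * \<xi>"
  "\<xi> ^ 9 = 34 * \<xi> - 21" "\<xi> ^ 10 = 34 - 55 * \<xi>"
  using \<xi>_power_add_2[of 2] \<xi>_power_add_2[of 3] \<xi>_power_add_2[of 4] \<xi>_power_add_2[of 5] \<xi>_power_add_2[of 6] \<xi>_power_add_2[of 7] \<xi>_power_add_2[of 8] \<xi>_square \<xi>_cube by simp_all

text \<open>These are the possible pairs of coordinates at two indices of fixed sum. The parameter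
  is the maximal coordinate for pairs below \<open>c\<close>, and one less for pairs above
  \<open>c\<close>, where wrapping around costs 1.\<close>

definition rungs :: "nat \<Rightarrow> (nat \<times> nat) set" where
  "rungs q = {(s, t). 1 \<le> s \<and> s \<le> q \<and> 1 \<le> t \<and> t \<le> q \<and> q \<le> s + t}"

text \<open>From \<open>r\<close> to \<open>u\<close> the first index moves up by \<open>a\<close>
  and the second moves down by \<open>a\<close>, so the inequality for a shift by \<open>a\<close>
  is read forwards in \<open>fst\<close> and backwards in \<open>snd\<close>.\<close>

definition rung_step :: "nat \<times> nat \<Rightarrow> nat \<times> nat \<Rightarrow> bool" where
  "rung_step r u \<longleftrightarrow> fst u \<le> fst r + 1 \<and> snd r \<le> snd u + 1"

definition rung_weight :: "nat \<times> nat \<Rightarrow> real" where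
  "rung_weight u = \<xi> ^ (fst u + snd u)"

text \<open>
  The constants leave room in all the numerical estimates below. A potential \<open>h\<close> makes the transfer
  operator contract by \<open>rate\<close>; the last \<open>a\<close> rungs of a ladder carry the potential 1 instead of \<open>h\<close>,
  so every estimate is needed for both. An unconstrained first rung costs at most \<open>penalty\<close>, and
  for \<open>q \<ge> 4\<close> every entry of a first rung known to be \<open>\<ge> 2\<close> gains this factor back.
\<close>

definition rate :: real where "rate = 199 / 200"

definition penalty :: real where "penalty = 29 / 25"

definition contracting :: "nat \<Rightarrow> (nat \<times> nat \<Rightarrow> real) \<Rightarrow> bool" where
  "contracting q h \<longleftrightarrow> (\<forall>r. 0 \<le> h r) \<and> (\<forall>p\<in>{\<lambda>_. 1, h}.
     (\<Sum>u\<in>rungs q. rung_weight u * p u) \<le> rate * penalty \<and>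
     (\<Sum>u | u \<in> rungs q \<and> 2 \<le> fst u. rung_weight u * p u) \<le> rate \<and>
     (4 \<le> q \<longrightarrow> (\<Sum>u | u \<in> rungs q \<and> 2 \<le> fst u. rung_weight u * p u) \<le> rate / penalty) \<and>
     (4 \<le> q \<longrightarrow> (\<Sum>u | u \<in> rungs q \<and> 2 \<le> fst u \<and> 2 \<le> snd u. rung_weight u * p u)
        \<le> rate / penalty ^ 2) \<and>
     (\<forall>r\<in>rungs q. (\<Sum>u | u \<in> rungs q \<and> rung_step r u. rung_weight u * p u) \<le> rate * h r))"

lemma finite_rungs [simp]: "finite (rungs q)"
  by (rule finite_subset[of _ "{..q} \<times> {..q}"]) (auto simp: rungs_def)

lemma sum_rungs_filter:
  "(\<Sum>u | u \<in> rungs q \<and> P u. f u) = (\<Sum>u\<in>rungs q. if P u then f u else (0::real))"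
  by (rule sum.inter_filter) simp

lemma atLeastAtMost_numerals:
  "{1..3::nat} = {1, 2, 3}" "{1..4::nat} = {1, 2, 3, 4}" "{1..5::nat} = {1, 2, 3, 4, 5}"
  by (auto simp: eval_nat_numeral le_Suc_eq)

lemma rungs_eq: "rungs q = {u \<in> {1..q} \<times> {1..q}. q \<le> fst u + snd u}"
  by (auto simp: rungs_def)

lemma sum_rungs: "sum f (rungs q) = (\<Sum>s=1..q. \<Sum>t=1..q. if q \<le> s + t then f (s, t) else (0::real))"
proof -
  have "sum f (rungs q) = (\<Sum>u\<in>{1..q} \<times> {1..q}. if q \<le> fst u + snd u then f u else 0)"
    unfolding rungs_eq by (simp add: sum.inter_filter)
  then show ?thesis by (auto simp: sum.cartesian_product intro!: sum.cong)
qed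

lemma sum_rungs_numerals:
  fixes f :: "nat \<times> nat \<Rightarrow> real"
  shows
    "sum f (rungs 3) = f (1, 2) + f (1, 3) + f (2, 1) + f (2, 2) + f (2, 3) + f (3, 1) + f (3, 2) + f (3, 3)"
    "sum f (rungs 4) = f (1, 3) + f (1, 4) + f (2, 2) + f (2, 3) + f (2, 4) + f (3, 1) + f (3, 2) + f (3, 3) + f (3, 4) + f (4, 1) + f (4, 2) + f (4, 3) + f (4, 4)"
    "sum f (rungs 5) = f (1, 4) + f (1, 5) + f (2, 3) + f (2, 4) + f (2, 5) + f (3, 2) + f (3, 3) + f (3, 4) + f (3, 5) + f (4, 1) + f (4, 2) + f (4, 3) + f (4, 4) + f (4, 5) + f (5, 1) + f (5, 2) + f (5, 3) + f (5, 4) + f (5, 5)"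
  unfolding sum_rungs atLeastAtMost_numerals by simp_all

lemma rungs_cases:
  "r \<in> rungs 3 \<Longrightarrow> r \<in> {(1, 2), (1, 3), (2, 1), (2, 2), (2, 3), (3, 1), (3, 2), (3, 3)}"
  "r \<in> rungs 4 \<Longrightarrow> r \<in> {(1, 3), (1, 4), (2, 2), (2, 3), (2, 4), (3, 1), (3, 2), (3, 3), (3, 4), (4, 1), (4, 2), (4, 3), (4, 4)}"
  unfolding rungs_eq atLeastAtMost_numerals by (elim CollectE conjE SigmaE insertE emptyE; simp)+

lemma rung_weight_numerals:
  "rung_weight (1, 4) = \<xi> ^ 5"
  "rung_weight (1, 5) = \<xi> ^ 6"
  "rung_weight (2, 3) = \<xi> ^ 5"
  "rung_weight (2, 4) = \<xi> ^ 6"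
  "rung_weight (2, 5) = \<xi> ^ 7"
  "rung_weight (3, 2) = \<xi> ^ 5"
  "rung_weight (3, 3) = \<xi> ^ 6"
  "rung_weight (3, 4) = \<xi> ^ 7"
  "rung_weight (3, 5) = \<xi> ^ 8"
  "rung_weight (4, 1) = \<xi> ^ 5"
  "rung_weight (4, 2) = \<xi> ^ 6"
  "rung_weight (4, 3) = \<xi> ^ 7"
  "rung_weight (4, 4) = \<xi> ^ 8"
  "rung_weight (4, 5) = \<xi> ^ 9"
  "rung_weight (5, 1) = \<xi> ^ 6"
  "rung_weight (5, 2) = \<xi> ^ 7"
  "rung_weight (5, 3) = \<xi> ^ 8"
  "rung_weight (5, 4) = \<xi> ^ 9"
  "rung_weight (5, 5) = \<xi> ^ 10"
  "rung_weight (1, 2) = \<xi> ^ 3"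
  "rung_weight (1, 3) = \<xi> ^ 4"
  "rung_weight (2, 1) = \<xi> ^ 3"
  "rung_weight (2, 2) = \<xi> ^ 4"
  "rung_weight (3, 1) = \<xi> ^ 4"
  by (simp_all add: rung_weight_def del: One_nat_def)

text \<open>A large second or a small first entry leaves fewer successors under
  \<open>rung_step\<close>, so such rungs get a smaller potential. The remaining rungs admit every
  successor and get \<open>29 / 25\<close>, which is \<open>penalty\<close>.\<close>

lemma contracting_3:
  "contracting 3 (\<lambda>u. if 3 \<le> snd u then 39 / 50 else if 2 \<le> fst u then 29 / 25 else 87 / 100)"
  unfolding contracting_def sum_rungs_filter sum_rungs_numerals rung_step_def rung_weight_numerals
    \<xi>_square \<xi>_cube \<xi>_powers rate_def penalty_def
  \<comment> \<open>There is one goal for each estimate, potential and rung \<open>r\<close>; each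
    is linear in \<xi>.\<close>
  apply (intro conjI allI ballI impI; (drule rungs_cases)?; (elim insertE emptyE)?; (simp add: power2_eq_square)?)
  by (use \<xi>_bounds in \<open>simp add: field_simps\<close>)+

lemma contracting_4: "contracting 4 (\<lambda>u. if 3 \<le> snd u then 17 / 20 else 11 / 10)"
  unfolding contracting_def sum_rungs_filter sum_rungs_numerals rung_step_def rung_weight_numerals
    \<xi>_square \<xi>_cube \<xi>_powers rate_def penalty_def
  apply (intro conjI allI ballI impI; (drule rungs_cases)?; (elim insertE emptyE)?; (simp add: power2_eq_square)?)
  by (use \<xi>_bounds in \<open>simp add: field_simps\<close>)+

text \<open>For \<open>q = 5\<close> the geometric estimate \<open>sum_rungs_fst_ge_le\<close> gives
  a total above 1, so this case is summed exactly.\<close>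

lemma sum_rungs_5_le:
  "(\<Sum>u\<in>rungs 5. rung_weight u) \<le> rate"
  "(\<Sum>u | u \<in> rungs 5 \<and> 2 \<le> fst u. rung_weight u) \<le> rate / penalty ^ 2"
  unfolding sum_rungs_filter sum_rungs_numerals rung_weight_numerals \<xi>_square \<xi>_cube \<xi>_powers
  by (use \<xi>_bounds in \<open>simp add: rate_def penalty_def power2_eq_square\<close>)+

lemma \<xi>_nonneg [simp]: "0 \<le> \<xi>" and \<xi>_le_1 [simp]: "\<xi> \<le> 1"
  using \<xi>_bounds by linarith+

lemma rung_weight_nonneg [simp]: "0 \<le> rung_weight u"
  by (simp add: rung_weight_def)

lemma rate_pos [simp]: "0 < rate" and penalty_pos [simp]: "0 < penalty" and penalty_ge_1: "1 \<le> penalty"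
  and rate_nonneg [simp]: "0 \<le> rate" and rate_le_1: "rate \<le> 1" and penalty_nonneg [simp]: "0 \<le> penalty"
  by (simp_all add: rate_def penalty_def)

text \<open>For a fixed first entry \<open>s\<close> the second entry runs over a geometric
  progression, starting at \<open>q - s\<close>, or at 1 when \<open>s = q\<close>. Since
  \<open>1 - \<xi> = \<xi> ^ 2\<close>, its sum is at most \<open>\<xi> ^ (q - 2)\<close>,
  respectively \<open>\<xi> ^ (q - 1)\<close>.\<close>

lemma sum_rungs_fst_ge_le:
  assumes "2 \<le> q" "1 \<le> l" "l \<le> q"
  shows "(\<Sum>u | u \<in> rungs q \<and> l \<le> fst u. rung_weight u) \<le> real (q - l) * \<xi> ^ (q - 2) + \<xi> ^ (q - 1)"
proof -
  have tail: "(\<Sum>t=n..q. \<xi> ^ t) \<le> \<xi> ^ n / \<xi>\<^sup>2" for n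
  proof -
    have "(\<Sum>t=n..q. \<xi> ^ t) * (1 - \<xi>) \<le> \<xi> ^ n"
    proof (cases "n \<le> q")
      case True
      then show ?thesis using sum_gp_multiplied[OF True, of \<xi>] by (simp add: mult.commute)
    qed simp
    then show ?thesis by (simp add: \<xi>_square pos_le_divide_eq)
  qed
  have inner: "(\<Sum>t=1..q. if q \<le> s + t then \<xi> ^ (s + t) else 0) \<le>
      (if s = q then \<xi> ^ (q - 1) else \<xi> ^ (q - 2))" if "s \<le> q" for s
  proof -
    let ?n = "if s = q then 1 else q - s"
    have "(\<Sum>t=1..q. if q \<le> s + t then \<xi> ^ (s + t) else 0) = \<xi> ^ s * (\<Sum>t=?n..q. \<xi> ^ t)"
      unfolding sum.inter_filter[symmetric, OF finite_atLeastAtMost] sum_distrib_left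
      using that by (intro sum.cong) (auto simp: power_add split: if_splits)
    also have "\<dots> \<le> \<xi> ^ s * (\<xi> ^ ?n / \<xi>\<^sup>2)"
      using tail by (intro mult_left_mono) auto
    also have "\<dots> = \<xi> ^ (s + ?n) / \<xi>\<^sup>2" by (simp add: power_add)
    also have "\<dots> = (if s = q then \<xi> ^ (q - 1) else \<xi> ^ (q - 2))"
      using that assms(1) less_imp_neq[OF \<xi>_pos] by (simp add: power_diff power2_eq_square)
    finally show ?thesis .
  qed
  have "(\<Sum>u | u \<in> rungs q \<and> l \<le> fst u. rung_weight u) =
      (\<Sum>s=1..q. if l \<le> s then \<Sum>t=1..q. if q \<le> s + t then \<xi> ^ (s + t) else 0 else 0)"
    unfolding sum_rungs_filter sum_rungs by (intro sum.cong refl) (auto simp: rung_weight_def intro!: sum.cong sum.neutral)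
  also have "\<dots> = (\<Sum>s=l..q. \<Sum>t=1..q. if q \<le> s + t then \<xi> ^ (s + t) else 0)"
    unfolding sum.inter_filter[symmetric, OF finite_atLeastAtMost]
    using assms by (intro sum.cong) auto
  also have "\<dots> \<le> (\<Sum>s=l..q. if s = q then \<xi> ^ (q - 1) else \<xi> ^ (q - 2))"
    by (intro sum_mono inner) auto
  also have "{l..q} = insert q {l..<q}" using assms by auto
  also have "(\<Sum>s\<in>insert q {l..<q}. if s = q then \<xi> ^ (q - 1) else \<xi> ^ (q - 2)) =
      real (q - l) * \<xi> ^ (q - 2) + \<xi> ^ (q - 1)"
    by simp
  finally show ?thesis .
qed

text \<open>Both expressions decrease from \<open>n = 4\<close> on, because
  \<open>(x + 1) * \<xi> \<le> x\<close> for \<open>x \<ge> 4\<close>; the value at 4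
  decides.\<close>

lemma linear_times_\<xi>_power_le:
  assumes "4 \<le> n"
  shows "(real n + 1) * \<xi> ^ n + \<xi> ^ (n + 1) \<le> 83 / 100" "real n * \<xi> ^ n + \<xi> ^ (n + 1) \<le> 7 / 10"
proof -
  have dec: "(real n + k + 1) * \<xi> ^ (n + 1) \<le> (real n + k) * \<xi> ^ n" if "0 \<le> k" "4 \<le> n" for n k
  proof -
    have "(real n + k + 1) * \<xi> \<le> (real n + k + 1) * (62 / 100)"
      using \<xi>_bounds that by (intro mult_left_mono) auto
    also have "\<dots> \<le> real n + k" using that by simp
    finally have "(real n + k + 1) * \<xi> * \<xi> ^ n \<le> (real n + k) * \<xi> ^ n"
      by (intro mult_right_mono) auto
    then show ?thesis by (simp add: mult_ac)
  qed
  have pow: "\<xi> ^ (n + 1) \<le> \<xi> ^ n" for n by (rule power_decreasing) auto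
  show "(real n + 1) * \<xi> ^ n + \<xi> ^ (n + 1) \<le> 83 / 100"
    using assms
  proof (induction n rule: dec_induct)
    case base
    then show ?case using \<xi>_bounds \<xi>_powers(1,2) by simp
  next
    case (step n)
    have "real (Suc n) + 1 = real n + 1 + 1" by simp
    then have "(real (Suc n) + 1) * \<xi> ^ Suc n \<le> (real n + 1) * \<xi> ^ n"
      using dec[of 1 n] step.hyps by (simp only: Suc_eq_plus1)
    moreover have "\<xi> ^ (Suc n + 1) \<le> \<xi> ^ (n + 1)" using pow[of "n + 1"] by simp
    ultimately show ?case using step.IH by linarith
  qed
  show "real n * \<xi> ^ n + \<xi> ^ (n + 1) \<le> 7 / 10"
    using assms
  proof (induction n rule: dec_induct)
    case base
    then show ?case using \<xi>_bounds \<xi>_powers(1,2) by simp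
  next
    case (step n)
    have "real (Suc n) = real n + 0 + 1" by simp
    then have "real (Suc n) * \<xi> ^ Suc n \<le> real n * \<xi> ^ n"
      using dec[of 0 n] step.hyps by (simp only: Suc_eq_plus1) simp
    moreover have "\<xi> ^ (Suc n + 1) \<le> \<xi> ^ (n + 1)" using pow[of "n + 1"] by simp
    ultimately show ?case using step.IH by linarith
  qed
qed

text \<open>The total rung weight is already at most \<open>rate\<close>, so the constant potential
  works. The bound \<open>rate / penalty ^ 2\<close> on rungs with first entry at least 2 implies
  the remaining estimates.\<close>

lemma contracting_ge_5:
  assumes "5 \<le> q"
  shows "contracting q (\<lambda>_. 1)"
proof -
  have "(\<Sum>u\<in>rungs q. rung_weight u) \<le> rate \<and>
    (\<Sum>u | u \<in> rungs q \<and> 2 \<le> fst u. rung_weight u) \<le> rate / penalty ^ 2"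
  proof (cases "q = 5")
    case True
    then show ?thesis using sum_rungs_5_le by simp
  next
    case False
    then have q: "6 \<le> q" using assms by simp
    define n where "n = q - 2"
    have n: "4 \<le> n" "q = n + 2" using q by (auto simp: n_def)
    have "{u \<in> rungs q. 1 \<le> fst u} = rungs q" by (auto simp: rungs_def)
    then have "(\<Sum>u\<in>rungs q. rung_weight u) \<le> (real n + 1) * \<xi> ^ n + \<xi> ^ (n + 1)"
      using sum_rungs_fst_ge_le[of q 1] n by (simp add: add_ac)
    moreover have "(\<Sum>u | u \<in> rungs q \<and> 2 \<le> fst u. rung_weight u) \<le> real n * \<xi> ^ n + \<xi> ^ (n + 1)"
      using sum_rungs_fst_ge_le[of q 2] n by simp
    ultimately show ?thesis
      using linear_times_\<xi>_power_le[OF n(1)]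
      by (simp add: rate_def penalty_def power2_eq_square)
  qed
  then have all: "(\<Sum>u\<in>rungs q. rung_weight u) \<le> rate"
    and pen: "(\<Sum>u | u \<in> rungs q \<and> 2 \<le> fst u. rung_weight u) \<le> rate / penalty ^ 2" by auto
  have sub: "(\<Sum>u | u \<in> rungs q \<and> P u. rung_weight u) \<le> rate" for P
    using all by (rule order_trans[rotated]) (rule sum_mono2; auto)
  have pen2: "(\<Sum>u | u \<in> rungs q \<and> 2 \<le> fst u \<and> 2 \<le> snd u. rung_weight u) \<le> rate / penalty ^ 2"
    using pen by (rule order_trans[rotated]) (rule sum_mono2; auto)
  have "rate \<le> rate * penalty" "rate / penalty ^ 2 \<le> rate / penalty" "rate / penalty ^ 2 \<le> rate"
    by (simp_all add: rate_def penalty_def power2_eq_square)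
  then have "(\<Sum>u\<in>rungs q. rung_weight u) \<le> rate * penalty"
    "(\<Sum>u | u \<in> rungs q \<and> 2 \<le> fst u. rung_weight u) \<le> rate / penalty"
    using all pen by (blast intro: order_trans)+
  then show ?thesis
    unfolding contracting_def using pen sub pen2 by simp
qed

lemma contractingD:
  assumes "contracting q h" "p \<in> {\<lambda>_. 1, h}"
  shows "(\<Sum>u\<in>rungs q. rung_weight u * p u) \<le> rate * penalty"
    "(\<Sum>u | u \<in> rungs q \<and> 2 \<le> fst u. rung_weight u * p u) \<le> rate"
    "4 \<le> q \<Longrightarrow> (\<Sum>u | u \<in> rungs q \<and> 2 \<le> fst u. rung_weight u * p u) \<le> rate / penalty"
    "4 \<le> q \<Longrightarrow> (\<Sum>u | u \<in> rungs q \<and> 2 \<le> fst u \<and> 2 \<le> snd u. rung_weight u * p u)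
        \<le> rate / penalty ^ 2"
    "r \<in> rungs q \<Longrightarrow> (\<Sum>u | u \<in> rungs q \<and> rung_step r u. rung_weight u * p u) \<le> rate * h r"
    "0 \<le> p u"
proof -
  note * = bspec[OF conjunct2[OF assms(1)[unfolded contracting_def]] assms(2)]
  show "(\<Sum>u\<in>rungs q. rung_weight u * p u) \<le> rate * penalty"
    "(\<Sum>u | u \<in> rungs q \<and> 2 \<le> fst u. rung_weight u * p u) \<le> rate"
    "4 \<le> q \<Longrightarrow> (\<Sum>u | u \<in> rungs q \<and> 2 \<le> fst u. rung_weight u * p u) \<le> rate / penalty"
    "4 \<le> q \<Longrightarrow> (\<Sum>u | u \<in> rungs q \<and> 2 \<le> fst u \<and> 2 \<le> snd u. rung_weight u * p u)
        \<le> rate / penalty ^ 2"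
    "r \<in> rungs q \<Longrightarrow> (\<Sum>u | u \<in> rungs q \<and> rung_step r u. rung_weight u * p u) \<le> rate * h r"
    using * by blast+
  show "0 \<le> p u" using assms unfolding contracting_def by fastforce
qed

lemma ex_contracting:
  assumes "3 \<le> q"
  obtains h where "contracting q h"
proof -
  have "q = 3 \<or> q = 4 \<or> 5 \<le> q" using assms by auto
  then show ?thesis using contracting_3 contracting_4 contracting_ge_5 that by blast
qed

lemma contracting_chains_le:
  assumes h: "contracting q h" and a: "0 < a"
    and V: "\<And>j. V j \<subseteq> rungs q"
    and \<beta>: "\<And>j. j < N \<Longrightarrow> 0 \<le> \<beta> j" "\<And>j. j < N \<Longrightarrow> a \<le> j \<Longrightarrow> rate \<le> \<beta> j"
    and start: "\<And>j p. j < N \<Longrightarrow> j < a \<Longrightarrow> p \<in> {\<lambda>_. 1, h} \<Longrightarrow> (\<Sum>u\<in>V j. rung_weight u * p u) \<le> \<beta> j"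
  shows "(\<Sum>xs\<in>chains a V rung_step N. \<Prod>j<N. rung_weight (xs ! j)) \<le> (\<Prod>j<N. \<beta> j)"
proof (rule sum_chains_le[where p = "\<lambda>j. if N \<le> j + a then \<lambda>_. 1 else h"])
  have h0: "0 \<le> h r" for r using h unfolding contracting_def by blast
  fix j r assume j: "j < N" "a \<le> j" and r: "r \<in> V (j - a)"
  define p where "p = (if N \<le> j + a then \<lambda>_. 1 else h)"
  have p: "p \<in> {\<lambda>_. 1, h}" by (auto simp: p_def)
  have "(\<Sum>u | u \<in> V j \<and> rung_step r u. rung_weight u * p u) \<le>
      (\<Sum>u | u \<in> rungs q \<and> rung_step r u. rung_weight u * p u)"
    using V[of j] p h0 by (intro sum_mono2) auto
  also have "\<dots> \<le> rate * h r"
    using contractingD(5)[OF h p] r V[of "j - a"] by blast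
  also have "\<dots> \<le> \<beta> j * h r" using \<beta>(2)[OF j] h0 by (intro mult_right_mono)
  \<comment> \<open>The entry \<open>j - a\<close> is followed by another one \<open>a\<close>
    places later, so it is not among the last \<open>a\<close> and carries \<open>h\<close>.\<close>
  also have "h r = (if N \<le> (j - a) + a then \<lambda>_. 1 else h) r" using j by simp
  finally show "(\<Sum>u | u \<in> V j \<and> rung_step r u. rung_weight u * (if N \<le> j + a then \<lambda>_. 1 else h) u)
      \<le> \<beta> j * (if N \<le> (j - a) + a then \<lambda>_. 1 else h) r" unfolding p_def .
next
  fix j assume "j < N" "j < a"
  then show "(\<Sum>u\<in>V j. rung_weight u * (if N \<le> j + a then \<lambda>_. 1 else h) u) \<le> \<beta> j"
    by (intro start) auto
next
  show "finite (V j)" for j using V by (rule finite_subset) simp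
qed (use h a \<beta> in \<open>auto simp: contracting_def\<close>)

section \<open>Total weights of the lower and upper ladders\<close>

text \<open>Rung \<open>j\<close> of the lower ladder sits at the indices \<open>j + 1\<close> and
  \<open>c - 1 - j\<close>, and rung \<open>j\<close> of the upper ladder has first index
  \<open>c + 1 + j\<close>. Indices below \<open>a\<close> have coordinate at least 2, by minimality
  of \<open>a\<close>.\<close>

definition lower_rungs :: "nat \<Rightarrow> nat \<Rightarrow> nat \<Rightarrow> nat \<Rightarrow> (nat \<times> nat) set" where
  "lower_rungs a c q j = {u \<in> rungs q. (j + 1 < a \<longrightarrow> 2 \<le> fst u) \<and> (c - 1 - j < a \<longrightarrow> 2 \<le> snd u)}"

definition upper_rungs :: "nat \<Rightarrow> nat \<Rightarrow> nat \<Rightarrow> nat \<Rightarrow> (nat \<times> nat) set" where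
  "upper_rungs a c q j = {u \<in> rungs q. c + 1 + j < a \<longrightarrow> 2 \<le> fst u}"

lemma prod_rate:
  fixes e :: "nat \<Rightarrow> nat"
  assumes "\<And>j. j < N \<Longrightarrow> f j = rate * penalty ^ e j"
  shows "(\<Prod>j<N. f j) = rate ^ N * penalty ^ (\<Sum>j<N. e j)"
  using assms by (simp add: prod.distrib power_sum)

text \<open>Only the first \<open>a\<close> rungs lack a predecessor. Those with
  \<open>c + 1 + j < a\<close> have first entry at least 2 and cost just \<open>rate\<close>; each
  of the others pays one \<open>penalty\<close>.\<close>

lemma upper_chains_le:
  assumes "3 \<le> q" "0 < a"
  shows "(\<Sum>xs\<in>chains a (upper_rungs a c q) rung_step N. \<Prod>j<N. rung_weight (xs ! j))
     \<le> rate ^ N * penalty ^ (\<Sum>j<N. of_bool (j < a \<and> a \<le> c + 1 + j))"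
proof -
  obtain h where h: "contracting q h" using ex_contracting[OF assms(1)] .
  let ?\<beta> = "\<lambda>j. rate * penalty ^ of_bool (j < a \<and> a \<le> c + 1 + j)"
  have "(\<Sum>xs\<in>chains a (upper_rungs a c q) rung_step N. \<Prod>j<N. rung_weight (xs ! j)) \<le> (\<Prod>j<N. ?\<beta> j)"
  proof (rule contracting_chains_le[OF h assms(2)])
    fix j p assume "j < N" "j < a" and p: "p \<in> {\<lambda>_. 1, h}"
    note D = contractingD[OF h p]
    show "(\<Sum>u\<in>upper_rungs a c q j. rung_weight u * p u) \<le> ?\<beta> j"
      using D(1,2) \<open>j < a\<close> by (cases "a \<le> c + 1 + j") (simp_all add: upper_rungs_def not_le)
  qed (auto simp: upper_rungs_def)
  also have "\<dots> = rate ^ N * penalty ^ (\<Sum>j<N. of_bool (j < a \<and> a \<le> c + 1 + j))"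
    by (rule prod_rate) simp
  finally show ?thesis .
qed

text \<open>Among the first \<open>a\<close> rungs only \<open>j = a - 1\<close>, whose first index
  is \<open>a\<close> itself, lacks a bound on its first entry, so \<open>penalty\<close> is paid at
  most once. For \<open>q \<ge> 4\<close> each entry known to be at least 2 is credited one factor
  \<open>penalty\<close>.\<close>

lemma lower_chains_le:
  assumes q: "3 \<le> q" and a: "0 < a" and N: "2 * N < c"
  shows "(\<Sum>xs\<in>chains a (lower_rungs a c q) rung_step N. \<Prod>j<N. rung_weight (xs ! j))
     \<le> rate ^ N * penalty"
    and "4 \<le> q \<Longrightarrow> (\<Sum>xs\<in>chains a (lower_rungs a c q) rung_step N. \<Prod>j<N. rung_weight (xs ! j))
     \<le> rate ^ N * penalty / penalty ^ (\<Sum>j<N. of_bool (j + 1 < a) + of_bool (c - 1 - j < a))"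
proof -
  obtain h where h: "contracting q h" using ex_contracting[OF assms(1)] .
  let ?L = "\<Sum>xs\<in>chains a (lower_rungs a c q) rung_step N. \<Prod>j<N. rung_weight (xs ! j)"
  let ?e = "\<lambda>j. of_bool (j + 1 = a) :: nat"
  let ?f = "\<lambda>j. of_bool (j + 1 < a) + of_bool (c - 1 - j < a) :: nat"
  have "(\<Sum>j<N. ?e j) \<le> (\<Sum>j<N. of_bool (j = a - 1))" using a by (intro sum_mono) auto
  also have "\<dots> \<le> 1" by (simp add: of_bool_def sum.delta)
  finally have e: "penalty ^ (\<Sum>j<N. ?e j) \<le> penalty ^ 1"
    by (intro power_increasing) (auto simp: penalty_ge_1)
  have nonneg: "0 \<le> rung_weight u * p u" if "p \<in> {\<lambda>_. 1, h}" for p u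
    using contractingD(6)[OF h that] by simp
  have "?L \<le> (\<Prod>j<N. rate * penalty ^ ?e j)"
  proof (rule contracting_chains_le[OF h a])
    fix j p assume j: "j < N" "j < a" and p: "p \<in> {\<lambda>_. 1, h}"
    note D = contractingD[OF h p]
    show "(\<Sum>u\<in>lower_rungs a c q j. rung_weight u * p u) \<le> rate * penalty ^ ?e j"
    proof (cases "j + 1 = a")
      case True
      have "(\<Sum>u\<in>lower_rungs a c q j. rung_weight u * p u) \<le> (\<Sum>u\<in>rungs q. rung_weight u * p u)"
        by (intro sum_mono2) (use nonneg[OF p] in \<open>auto simp: lower_rungs_def\<close>)
      then show ?thesis using True D(1) by simp
    next
      case False
      then have "j + 1 < a" using j by simp
      then have "(\<Sum>u\<in>lower_rungs a c q j. rung_weight u * p u)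
          \<le> (\<Sum>u | u \<in> rungs q \<and> 2 \<le> fst u. rung_weight u * p u)"
        by (intro sum_mono2) (use nonneg[OF p] in \<open>auto simp: lower_rungs_def\<close>)
      then show ?thesis using False D(2) by simp
    qed
  qed (auto simp: lower_rungs_def penalty_ge_1)
  also have "\<dots> = rate ^ N * penalty ^ (\<Sum>j<N. ?e j)" by (rule prod_rate) simp
  also have "\<dots> \<le> rate ^ N * penalty" using e by simp
  finally show "?L \<le> rate ^ N * penalty" .
  assume q4: "4 \<le> q"
  have "?L \<le> (\<Prod>j<N. rate * penalty ^ ?e j / penalty ^ ?f j)"
  proof (rule contracting_chains_le[OF h a])
    fix j p assume j: "j < N" "j < a" and p: "p \<in> {\<lambda>_. 1, h}"
    note D = contractingD[OF h p]
    show "(\<Sum>u\<in>lower_rungs a c q j. rung_weight u * p u) \<le> rate * penalty ^ ?e j / penalty ^ ?f j"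
    proof (cases "j + 1 = a")
      case True
      have "(\<Sum>u\<in>lower_rungs a c q j. rung_weight u * p u) \<le> (\<Sum>u\<in>rungs q. rung_weight u * p u)"
        by (intro sum_mono2) (use nonneg[OF p] in \<open>auto simp: lower_rungs_def\<close>)
      moreover have "\<not> c - 1 - j < a" using True j N by simp
      ultimately show ?thesis using True D(1) by simp
    next
      case False
      then have "j + 1 < a" using j by simp
      then show ?thesis using D(3,4)[OF q4]
        by (cases "c - 1 - j < a") (simp_all add: lower_rungs_def power2_eq_square conj_assoc)
    qed
  next
    fix j assume "j < N" "a \<le> j"
    then have "\<not> c - 1 - j < a" using N by simp
    then show "rate \<le> rate * penalty ^ ?e j / penalty ^ ?f j"
      using \<open>a \<le> j\<close> by simp
  qed (auto simp: lower_rungs_def)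
  also have "\<dots> = (\<Prod>j<N. rate * penalty ^ ?e j) / penalty ^ (\<Sum>j<N. ?f j)"
    unfolding prod_dividef by (simp add: power_sum)
  also have "(\<Prod>j<N. rate * penalty ^ ?e j) = rate ^ N * penalty ^ (\<Sum>j<N. ?e j)"
    by (rule prod_rate) simp
  also have "rate ^ N * penalty ^ (\<Sum>j<N. ?e j) / penalty ^ (\<Sum>j<N. ?f j)
      \<le> rate ^ N * penalty / penalty ^ (\<Sum>j<N. ?f j)"
    using e by (intro divide_right_mono mult_left_mono) auto
  finally show "?L \<le> rate ^ N * penalty / penalty ^ (\<Sum>j<N. ?f j)" .
qed

text \<open>The left side is at most \<open>min a (c + 1)\<close>; the two sums on the right equal
  \<open>min N (a - 1)\<close> and \<open>N - (c - a)\<close>. As \<open>2 * N\<close> is at least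
  \<open>c - 2\<close>, the discrepancy is at most 3.\<close>

lemma unpenalized_starts_le:
  fixes a c N M :: nat
  assumes "c \<le> 2 * N + 2" "2 * N < c"
  shows "(\<Sum>j<M. of_bool (j < a \<and> a \<le> c + 1 + j) :: nat)
    \<le> (\<Sum>j<N. of_bool (j + 1 < a) + of_bool (c - 1 - j < a)) + 3"
proof -
  have "(\<Sum>j<M. of_bool (j < a \<and> a \<le> c + 1 + j) :: nat) = card ({..<M} \<inter> {j. j < a \<and> a \<le> c + 1 + j})"
    by (simp add: sum_of_bool_eq)
  also have "\<dots> \<le> card {a - (c + 1)..<a}" by (intro card_mono) auto
  finally have 1: "(\<Sum>j<M. of_bool (j < a \<and> a \<le> c + 1 + j) :: nat) \<le> a - (a - (c + 1))" by simp
  have "(\<Sum>j<N. of_bool (j + 1 < a) :: nat) = card ({..<N} \<inter> {j. j + 1 < a})"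
    by (simp add: sum_of_bool_eq)
  also have "{..<N} \<inter> {j. j + 1 < a} = {..<min N (a - 1)}" by auto
  finally have 2: "(\<Sum>j<N. of_bool (j + 1 < a) :: nat) = min N (a - 1)" by simp
  have "(\<Sum>j<N. of_bool (c - 1 - j < a) :: nat) = card ({..<N} \<inter> {j. c - 1 - j < a})"
    by (simp add: sum_of_bool_eq)
  also have "{..<N} \<inter> {j. c - 1 - j < a} = {c - a..<N}" using assms by auto
  finally have 3: "(\<Sum>j<N. of_bool (c - 1 - j < a) :: nat) = N - (c - a)" by simp
  show ?thesis unfolding sum.distrib 2 3 using 1 assms by (auto simp: min_def)
qed

text \<open>
  An upper ladder with unconstrained first index \<open>i \<ge> a\<close> costs a factor \<open>penalty\<close>. Then \<open>0 \<le> c - (i - a) < a\<close>,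
  so up to three exceptions this index has coordinate \<open>\<ge> 2\<close> and gains the factor back in a lower ladder.
\<close>

lemma ladders_le:
  assumes q: "4 \<le> q" and a: "0 < a" and N: "2 * N < c" "c \<le> 2 * N + 2"
  shows "(\<Sum>xs\<in>chains a (lower_rungs a c q) rung_step N. \<Prod>j<N. rung_weight (xs ! j)) *
    (\<Sum>xs\<in>chains a (upper_rungs a c (q - 1)) rung_step M. \<Prod>j<M. rung_weight (xs ! j))
    \<le> 2 * rate ^ (N + M)" (is "?L * ?U \<le> _")
proof -
  let ?u = "\<Sum>j<M. of_bool (j < a \<and> a \<le> c + 1 + j) :: nat"
  let ?l = "\<Sum>j<N. of_bool (j + 1 < a) + of_bool (c - 1 - j < a) :: nat"
  have "?L * ?U \<le> (rate ^ N * penalty / penalty ^ ?l) * (rate ^ M * penalty ^ ?u)"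
    using q a N by (intro mult_mono lower_chains_le upper_chains_le)
      (auto intro!: sum_nonneg prod_nonneg)
  also have "\<dots> \<le> (rate ^ N * penalty / penalty ^ ?l) * (rate ^ M * penalty ^ (?l + 3))"
    using unpenalized_starts_le[OF N(2,1)] penalty_ge_1
    by (intro mult_left_mono power_increasing) auto
  \<comment> \<open>One factor comes from the lower ladder and three from the exceptional indices;
    \<open>penalty ^ 4\<close> is below 2.\<close>
  also have "\<dots> = penalty ^ 4 * rate ^ (N + M)"
    using less_imp_neq[OF penalty_pos] by (simp add: power_add eval_nat_numeral)
  also have "\<dots> \<le> 2 * rate ^ (N + M)" by (simp add: penalty_def power_divide)
  finally show ?thesis .
qed

section \<open>Semigroups with large Kunz coordinates\<close>

text \<open>The value \<open>a = m\<close> stands for the absence of coordinate 1.\<close>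

definition deep_class :: "nat \<Rightarrow> nat \<Rightarrow> nat \<Rightarrow> nat \<Rightarrow> nat \<Rightarrow> nat set set" where
  "deep_class g m q c a = {S \<in> semigroups_of_genus g. mult S = m \<and> kunz S c = q \<and>
     (\<forall>i. 0 < i \<and> i < m \<longrightarrow> kunz S i \<le> q) \<and> (\<forall>i. c < i \<and> i < m \<longrightarrow> kunz S i \<le> q - 1) \<and>
     (\<forall>i. 0 < i \<and> i < a \<longrightarrow> 2 \<le> kunz S i) \<and> (a = m \<or> kunz S a = 1)}"

text \<open>The paired indices sum to \<open>c\<close>, and to \<open>c + mult S\<close> in
  \<open>upper_ladder\<close>. Depending on parity, a middle index stays unpaired in either
  ladder.\<close>

definition lower_ladder :: "nat \<Rightarrow> nat set \<Rightarrow> (nat \<times> nat) list" where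
  "lower_ladder c S = map (\<lambda>j. (kunz S (j + 1), kunz S (c - 1 - j))) [0..<(c - 1) div 2]"

definition upper_ladder :: "nat \<Rightarrow> nat set \<Rightarrow> (nat \<times> nat) list" where
  "upper_ladder c S = map (\<lambda>j. (kunz S (c + 1 + j), kunz S (mult S - 1 - j))) [0..<(mult S - 1 - c) div 2]"

text \<open>Subadditivity at the index sum \<open>c\<close> gives the rungs; adding the index
  \<open>a\<close>, of coordinate 1, gives the steps.\<close>

lemma lower_ladder_mem_chains:
  assumes S: "S \<in> deep_class g m q c a" and c: "0 < c" "c < m" and a: "0 < a" "a \<le> m"
  shows "lower_ladder c S \<in> chains a (lower_rungs a c q) rung_step ((c - 1) div 2)"
proof -
  let ?N = "(c - 1) div 2" and ?k = "kunz S"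
  have ns: "numerical_semigroup S" and m: "mult S = m" and kc: "?k c = q"
    and le: "\<And>i. 0 < i \<Longrightarrow> i < m \<Longrightarrow> ?k i \<le> q"
    and ge: "\<And>i. 0 < i \<Longrightarrow> i < a \<Longrightarrow> 2 \<le> ?k i"
    and ka: "a < m \<Longrightarrow> ?k a = 1"
    using S by (auto simp: deep_class_def semigroups_of_genus_def)
  have pos: "1 \<le> ?k i" if "0 < i" "i < m" for i using kunz_pos[OF ns] that m by simp
  have rung: "(?k (j + 1), ?k (c - 1 - j)) \<in> lower_rungs a c q j" if j: "j < ?N" for j
  proof -
    have "?k ((j + 1) + (c - 1 - j)) \<le> ?k (j + 1) + ?k (c - 1 - j)" by (rule kunz_add_le[OF ns])
    moreover have "(j + 1) + (c - 1 - j) = c" "0 < c - 1 - j" "c - 1 - j < m" "j + 1 < m"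
      using j c by auto
    ultimately show ?thesis
      using le pos ge kc by (auto simp: lower_rungs_def rungs_def)
  qed
  have step: "rung_step (?k (j - a + 1), ?k (c - 1 - (j - a))) (?k (j + 1), ?k (c - 1 - j))"
    if j: "j < ?N" "a \<le> j" for j
  proof -
    \<comment> \<open>A step exists only for \<open>a \<le> j < m\<close>, so here \<open>a\<close>
      is a genuine index of coordinate 1.\<close>
    have "a < m" using j c by auto
    then have 1: "?k a = 1" by (rule ka)
    have "?k ((j - a + 1) + a) \<le> ?k (j - a + 1) + ?k a" by (rule kunz_add_le[OF ns])
    moreover have "?k ((c - 1 - j) + a) \<le> ?k (c - 1 - j) + ?k a" by (rule kunz_add_le[OF ns])
    moreover have "(j - a + 1) + a = j + 1" "(c - 1 - j) + a = c - 1 - (j - a)" using j by auto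
    ultimately show ?thesis using 1 by (simp add: rung_step_def)
  qed
  show ?thesis using rung step by (auto simp: chains_def lower_ladder_def)
qed

text \<open>As below \<open>c\<close>, but the paired indices sum to \<open>c + m\<close>, and
  \<open>kunz_add_mult\<close> bounds the coordinate there below by \<open>q - 1\<close>.\<close>

lemma upper_ladder_mem_chains:
  assumes S: "S \<in> deep_class g m q c a" and c: "0 < c" "c < m" and a: "0 < a" "a \<le> m"
  shows "upper_ladder c S \<in> chains a (upper_rungs a c (q - 1)) rung_step ((m - 1 - c) div 2)"
proof -
  let ?N = "(m - 1 - c) div 2" and ?k = "kunz S"
  have ns: "numerical_semigroup S" and m: "mult S = m" and kc: "?k c = q"
    and le: "\<And>i. c < i \<Longrightarrow> i < m \<Longrightarrow> ?k i \<le> q - 1"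
    and ge: "\<And>i. 0 < i \<Longrightarrow> i < a \<Longrightarrow> 2 \<le> ?k i"
    and ka: "a < m \<Longrightarrow> ?k a = 1"
    using S by (auto simp: deep_class_def semigroups_of_genus_def)
  have pos: "1 \<le> ?k i" if "0 < i" "i < m" for i using kunz_pos[OF ns] that m by simp
  have rung: "(?k (c + 1 + j), ?k (m - 1 - j)) \<in> upper_rungs a c (q - 1) j" if j: "j < ?N" for j
  proof -
    have "?k ((c + 1 + j) + (m - 1 - j)) \<le> ?k (c + 1 + j) + ?k (m - 1 - j)" by (rule kunz_add_le[OF ns])
    moreover have "(c + 1 + j) + (m - 1 - j) = c + m" "c < m - 1 - j" "m - 1 - j < m" "c + 1 + j < m"
      using j c by auto
    moreover have "?k c \<le> ?k (c + m) + 1" using kunz_add_mult[OF ns] m by blast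
    ultimately show ?thesis
      using le[of "c + 1 + j"] le[of "m - 1 - j"] pos[of "c + 1 + j"] pos[of "m - 1 - j"]
        ge[of "c + 1 + j"] kc by (auto simp: upper_rungs_def rungs_def)
  qed
  have step: "rung_step (?k (c + 1 + (j - a)), ?k (m - 1 - (j - a))) (?k (c + 1 + j), ?k (m - 1 - j))"
    if j: "j < ?N" "a \<le> j" for j
  proof -
    have "a < m" using j c by auto
    then have 1: "?k a = 1" by (rule ka)
    have "?k ((c + 1 + (j - a)) + a) \<le> ?k (c + 1 + (j - a)) + ?k a" by (rule kunz_add_le[OF ns])
    moreover have "?k ((m - 1 - j) + a) \<le> ?k (m - 1 - j) + ?k a" by (rule kunz_add_le[OF ns])
    moreover have "(c + 1 + (j - a)) + a = c + 1 + j" "(m - 1 - j) + a = m - 1 - (j - a)" using j by auto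
    ultimately show ?thesis using 1 by (simp add: rung_step_def)
  qed
  show ?thesis using rung step m by (auto simp: chains_def upper_ladder_def)
qed

text \<open>The ladder entries occupy four disjoint blocks of indices inside
  \<open>{1..<m}\<close>.\<close>

lemma sum_ladders_le:
  fixes k :: "nat \<Rightarrow> nat"
  assumes c: "0 < c" "c < m"
  shows "(\<Sum>j<(c - 1) div 2. k (j + 1) + k (c - 1 - j)) +
    (\<Sum>j<(m - 1 - c) div 2. k (c + 1 + j) + k (m - 1 - j)) \<le> (\<Sum>i=1..<m. k i)"
proof -
  define N M where "N = (c - 1) div 2" and "M = (m - 1 - c) div 2"
  have N: "2 * N + 1 \<le> c" and M: "c + 1 + 2 * M \<le> m" using c by (auto simp: N_def M_def)
  have up: "(\<Sum>j<n. k (b + j)) = sum k {b..<b + n}" for b n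
    by (rule sum.reindex_bij_witness[of _ "\<lambda>i. i - b" "\<lambda>j. b + j"]) auto
  have down: "(\<Sum>j<n. k (b - 1 - j)) = sum k {b - n..<b}" if "n \<le> b" for b n
    by (rule sum.reindex_bij_witness[of _ "\<lambda>i. b - 1 - i" "\<lambda>j. b - 1 - j"]) (use that in auto)
  have 1: "(\<Sum>j<N. k (j + 1)) = sum k {1..<1 + N}" using up[of 1 N] by (simp add: add.commute)
  have 2: "(\<Sum>j<N. k (c - 1 - j)) = sum k {c - N..<c}" using N by (intro down) auto
  have 3: "(\<Sum>j<M. k (c + 1 + j)) = sum k {c + 1..<c + 1 + M}" by (rule up)
  have 4: "(\<Sum>j<M. k (m - 1 - j)) = sum k {m - M..<m}" using M by (intro down) auto
  have "(\<Sum>j<N. k (j + 1) + k (c - 1 - j)) + (\<Sum>j<M. k (c + 1 + j) + k (m - 1 - j)) =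
      sum k {1..<1 + N} + sum k {c - N..<c} + (sum k {c + 1..<c + 1 + M} + sum k {m - M..<m})"
    unfolding sum.distrib 1 2 3 4 ..
  also have "\<dots> = sum k ({1..<1 + N} \<union> {c - N..<c}) + sum k ({c + 1..<c + 1 + M} \<union> {m - M..<m})"
    using N M by (subst (1 2) sum.union_disjoint) auto
  also have "\<dots> = sum k (({1..<1 + N} \<union> {c - N..<c}) \<union> ({c + 1..<c + 1 + M} \<union> {m - M..<m}))"
    using N M by (intro sum.union_disjoint[symmetric]) auto
  also have "\<dots> \<le> sum k {1..<m}" using N M by (intro sum_mono2) auto
  finally show ?thesis by (simp add: N_def M_def)
qed

text \<open>The ladders miss only \<open>c\<close>, whose coordinate is \<open>q\<close>, and at
  most two middle indices, whose coordinates are recorded separately.\<close>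

lemma inj_on_ladders:
  assumes c: "0 < c" "c < m"
  shows "inj_on (\<lambda>S. (lower_ladder c S, upper_ladder c S,
    kunz S (c div 2), kunz S (c + 1 + (m - 1 - c) div 2))) (deep_class g m q c a)"
proof (rule inj_onI)
  fix S T assume ST: "S \<in> deep_class g m q c a" "T \<in> deep_class g m q c a"
    and eq: "(lower_ladder c S, upper_ladder c S, kunz S (c div 2), kunz S (c + 1 + (m - 1 - c) div 2)) =
      (lower_ladder c T, upper_ladder c T, kunz T (c div 2), kunz T (c + 1 + (m - 1 - c) div 2))"
  define N M where "N = (c - 1) div 2" and "M = (m - 1 - c) div 2"
  have ns: "numerical_semigroup S" "numerical_semigroup T" and m: "mult S = m" "mult T = m"
    and kc: "kunz S c = q" "kunz T c = q"
    using ST by (auto simp: deep_class_def semigroups_of_genus_def)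
  have c2: "c \<le> 2 * N + 2" and m2: "m \<le> c + 2 * M + 2" using c by (auto simp: N_def M_def)
  have lower: "kunz S (j + 1) = kunz T (j + 1) \<and> kunz S (c - 1 - j) = kunz T (c - 1 - j)" if "j < N" for j
    using eq that by (auto simp: lower_ladder_def N_def)
  have upper: "kunz S (c + 1 + j) = kunz T (c + 1 + j) \<and> kunz S (m - 1 - j) = kunz T (m - 1 - j)" if "j < M" for j
    using eq that m by (auto simp: upper_ladder_def M_def)
  have mid: "kunz S (c div 2) = kunz T (c div 2)" "kunz S (c + 1 + M) = kunz T (c + 1 + M)"
    using eq by (auto simp: M_def)
  have "kunz S i = kunz T i" if i: "1 \<le> i" "i < m" for i
  proof -
    show ?thesis
    proof (cases "i = c \<or> i = c div 2 \<or> i = c + 1 + M \<or> i \<le> N")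
      case True
      moreover have "kunz S i = kunz T i" if "i \<le> N" using lower[of "i - 1"] i that by simp
      ultimately show ?thesis using kc mid by (elim disjE) simp_all
    next
      case False
      show ?thesis
      proof (cases "i < c")
        case True
        then have "c - 1 - (c - 1 - i) = i" by simp
        \<comment> \<open>For even \<open>c\<close> the unpaired index is
          \<open>N + 1 = c div 2\<close>, which has been excluded.\<close>
        moreover have "c \<le> 2 * N + 1 \<or> N + 1 < i"
        proof (rule ccontr)
          assume "\<not> ?thesis"
          then have "c = 2 * N + 2" "i = N + 1" using False c2 by auto
          then show False using False by simp
        qed
        then have "c - 1 - i < N" using True False c2 by auto
        ultimately show ?thesis using lower[of "c - 1 - i"] by simp
      next
        case ge: False
        show ?thesis
        proof (cases "i \<le> c + M")
          case True
          then have "c + 1 + (i - c - 1) = i" "i - c - 1 < M" using ge False by auto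
          then show ?thesis using upper[of "i - c - 1"] by simp
        next
          case gt: False
          have "m - 1 - (m - 1 - i) = i" using i by simp
          moreover have "c + 1 + M < i" using gt False by auto
          then have "m - 1 - i < M" using m2 i by linarith
          ultimately show ?thesis using upper[of "m - 1 - i"] by simp
        qed
      qed
    qed
  qed
  then show "S = T" by (intro kunz_inject[OF ns]) (use m in auto)
qed

text \<open>By injectivity the class embeds into pairs of chains with two middle coordinates, each
  at most \<open>g\<close>. Omitting indices only increases the \<xi>-weight, so
  \<open>\<xi> ^ g\<close> is bounded by the ladder weights.\<close>

lemma card_deep_class_le:
  assumes c: "0 < c" "c < m" and a: "0 < a" "a \<le> m"
  shows "real (card (deep_class g m q c a)) * \<xi> ^ g \<le>
    (\<Sum>xs\<in>chains a (lower_rungs a c q) rung_step ((c - 1) div 2). \<Prod>j<(c - 1) div 2. rung_weight (xs ! j)) *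
    (\<Sum>xs\<in>chains a (upper_rungs a c (q - 1)) rung_step ((m - 1 - c) div 2).
       \<Prod>j<(m - 1 - c) div 2. rung_weight (xs ! j)) * (real g + 1) ^ 2"
proof -
  define N M where "N = (c - 1) div 2" and "M = (m - 1 - c) div 2"
  define L where "L = chains a (lower_rungs a c q) rung_step N"
  define U where "U = chains a (upper_rungs a c (q - 1)) rung_step M"
  let ?X = "deep_class g m q c a"
  let ?W = "\<lambda>n xs. \<Prod>j<n. rung_weight (xs ! j)"
  let ?f = "\<lambda>S. (lower_ladder c S, upper_ladder c S, kunz S (c div 2), kunz S (c + 1 + M))"
  let ?F = "\<lambda>(xs, ys, z). ?W N xs * ?W M ys"
  have fin: "finite L" "finite U" unfolding L_def U_def
    by (intro finite_chains a; auto simp: lower_rungs_def upper_rungs_def)+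
  have W0: "0 \<le> ?W n xs" for n xs by (intro prod_nonneg) simp
  have sub: "?f ` ?X \<subseteq> L \<times> U \<times> {..g} \<times> {..g}"
    using lower_ladder_mem_chains[OF _ c a] upper_ladder_mem_chains[OF _ c a] kunz_le_genus
    unfolding L_def U_def N_def M_def by (fastforce simp: deep_class_def semigroups_of_genus_def)
  have wt: "\<xi> ^ g \<le> ?F (?f S)" if S: "S \<in> ?X" for S
  proof -
    have ns: "numerical_semigroup S" and m: "mult S = m" and g: "genus S = g"
      using S by (auto simp: deep_class_def semigroups_of_genus_def)
    have "?W N (lower_ladder c S) = (\<Prod>j<N. \<xi> ^ (kunz S (j + 1) + kunz S (c - 1 - j)))"
      by (intro prod.cong refl) (simp add: lower_ladder_def rung_weight_def N_def)
    moreover have "?W M (upper_ladder c S) = (\<Prod>j<M. \<xi> ^ (kunz S (c + 1 + j) + kunz S (m - 1 - j)))"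
      by (intro prod.cong refl) (simp add: upper_ladder_def rung_weight_def M_def m)
    ultimately have "?F (?f S) = \<xi> ^ ((\<Sum>j<N. kunz S (j + 1) + kunz S (c - 1 - j)) +
        (\<Sum>j<M. kunz S (c + 1 + j) + kunz S (m - 1 - j)))"
      by (simp only: prod.case power_add[of \<xi> "sum _ _"] power_sum)
    moreover have "(\<Sum>j<N. kunz S (j + 1) + kunz S (c - 1 - j)) +
        (\<Sum>j<M. kunz S (c + 1 + j) + kunz S (m - 1 - j)) \<le> g"
      using sum_ladders_le[OF c, of "kunz S"] sum_kunz[OF ns] m g by (simp add: N_def M_def)
    ultimately show ?thesis by (simp add: power_decreasing)
  qed
  have "real (card ?X) * \<xi> ^ g \<le> (\<Sum>S\<in>?X. ?F (?f S))"
    using sum_mono[of ?X "\<lambda>_. \<xi> ^ g", OF wt] by simp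
  also have "\<dots> = sum ?F (?f ` ?X)"
    using inj_on_ladders[OF c] by (subst sum.reindex) (auto simp: M_def)
  also have "\<dots> \<le> sum ?F (L \<times> U \<times> {..g} \<times> {..g})"
    using sub fin W0 by (intro sum_mono2) auto
  also have "\<dots> = (\<Sum>xs\<in>L. \<Sum>ys\<in>U. \<Sum>z\<le>g. \<Sum>z'\<le>g. ?W N xs * ?W M ys)"
    by (simp only: sum.cartesian_product' prod.case)
  also have "\<dots> = (\<Sum>xs\<in>L. \<Sum>ys\<in>U. ?W N xs * ?W M ys * (real g + 1) ^ 2)"
    by (simp add: power2_eq_square algebra_simps)
  also have "\<dots> = sum (?W N) L * sum (?W M) U * (real g + 1) ^ 2"
    by (simp only: sum_product flip: sum_distrib_right)
  finally show ?thesis unfolding L_def U_def N_def M_def .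
qed

text \<open>This is \<open>(\<xi> + \<xi> ^ 2) ^ 2 = 1\<close>. Hence the upper ladder yields no
  decay when \<open>q = 3\<close>, and decay must come from indices below \<open>c\<close>.\<close>

lemma sum_rungs_2: "(\<Sum>u\<in>rungs 2. rung_weight u) = 1"
proof -
  have "{1..2::nat} = {1, 2}" by auto
  then have "(\<Sum>u\<in>rungs 2. rung_weight u) = \<xi> ^ 2 + 2 * \<xi> ^ 3 + \<xi> ^ 4"
    unfolding sum_rungs by (simp add: rung_weight_def eval_nat_numeral)
  then show ?thesis by (simp add: \<xi>_square \<xi>_cube \<xi>_powers)
qed

text \<open>For \<open>q = 3\<close> only the lower ladder contracts, and \<open>c\<close> is at
  least \<open>\<epsilon> * m\<close>. For \<open>q \<ge> 4\<close> both ladders contract, and their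
  joint length is about \<open>m / 2\<close>.\<close>

lemma card_deep_class_le_rate:
  assumes c: "0 < c" "c < m" and a: "0 < a" "a \<le> m" and q: "3 \<le> q"
    and "\<epsilon> \<le> 1" "q = 3 \<Longrightarrow> \<epsilon> * real m \<le> real c"
  shows "real (card (deep_class g m q c a)) * \<xi> ^ g \<le> 4 * rate powr (\<epsilon> * real m / 2) * (real g + 1) ^ 2"
proof -
  define N M where "N = (c - 1) div 2" and "M = (m - 1 - c) div 2"
  let ?L = "\<Sum>xs\<in>chains a (lower_rungs a c q) rung_step N. \<Prod>j<N. rung_weight (xs ! j)"
  let ?U = "\<Sum>xs\<in>chains a (upper_rungs a c (q - 1)) rung_step M. \<Prod>j<M. rung_weight (xs ! j)"
  have N: "2 * N < c" "c \<le> 2 * N + 2" and M: "m \<le> c + 2 * M + 2" using c by (auto simp: N_def M_def)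
  \<comment> \<open>The shift by 2 absorbs the rounding in \<open>N\<close> and \<open>M\<close> and
    the unpaired indices.\<close>
  have rate: "rate ^ n \<le> rate powr (x - 2)" if "x \<le> real n + 2" for n x
    using that rate_le_1 by (simp add: powr_mono' flip: powr_realpow)
  have L0: "0 \<le> ?L" by (intro sum_nonneg prod_nonneg) auto
  have "?L * ?U \<le> 2 * rate powr (\<epsilon> * real m / 2 - 2)"
  proof (cases "q = 3")
    case True
    have "?U \<le> (\<Prod>j<M. 1)"
    proof (rule sum_chains_le[where p = "\<lambda>_ _. 1"])
      have le1: "(\<Sum>u\<in>A. rung_weight u) \<le> 1" if "A \<subseteq> rungs 2" for A
        using sum_mono2[of "rungs 2" A rung_weight] that sum_rungs_2 by simp
      show "(\<Sum>s\<in>upper_rungs a c (q - 1) j. rung_weight s * 1) \<le> 1" for j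
        using True le1 by (auto simp: upper_rungs_def)
      show "(\<Sum>s | s \<in> upper_rungs a c (q - 1) j \<and> rung_step r s. rung_weight s * 1) \<le> 1 * 1" for j r
        using True le1[of "{s \<in> upper_rungs a c 2 j. rung_step r s}"] by (auto simp: upper_rungs_def)
    qed (use a in \<open>auto simp: upper_rungs_def\<close>)
    then have "?L * ?U \<le> ?L" using L0 by (simp add: mult_left_le)
    also have "\<dots> \<le> rate ^ N * penalty" using lower_chains_le(1)[OF q a(1) N(1)] .
    also have "\<dots> \<le> rate ^ N * 2" by (intro mult_left_mono) (auto simp: penalty_def)
    also have "\<dots> \<le> rate powr (\<epsilon> * real m / 2 - 2) * 2"
    proof (intro mult_right_mono rate)
      have "\<epsilon> * real m \<le> real c" using assms True by simp
      also have "real c \<le> 2 * real N + 2" using N by linarith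
      finally show "\<epsilon> * real m / 2 \<le> real N + 2" by simp
    qed simp
    finally show ?thesis by simp
  next
    case False
    then have "?L * ?U \<le> 2 * rate ^ (N + M)" using q a N by (intro ladders_le) auto
    also have "\<dots> \<le> 2 * rate powr (\<epsilon> * real m / 2 - 2)"
    proof (intro mult_left_mono rate)
      have "\<epsilon> * real m \<le> 1 * real m" using assms by (intro mult_right_mono) auto
      also have "m \<le> 2 * N + 2 * M + 4" using N(2) M by arith
      then have "1 * real m \<le> 2 * real (N + M) + 4" by simp
      finally show "\<epsilon> * real m / 2 \<le> real (N + M) + 2" by simp
    qed simp
    finally show ?thesis .
  qed
  also have "\<dots> = 2 * (rate powr (\<epsilon> * real m / 2) / rate ^ 2)"
    by (simp add: powr_diff powr_numeral)
  also have "\<dots> \<le> 4 * rate powr (\<epsilon> * real m / 2)"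
    by (simp add: rate_def power2_eq_square)
  finally have LU: "?L * ?U \<le> 4 * rate powr (\<epsilon> * real m / 2)" .
  have "real (card (deep_class g m q c a)) * \<xi> ^ g \<le> ?L * ?U * (real g + 1) ^ 2"
    using card_deep_class_le[OF c a] by (simp add: N_def M_def)
  also have "\<dots> \<le> 4 * rate powr (\<epsilon> * real m / 2) * (real g + 1) ^ 2"
    using LU by (intro mult_right_mono) auto
  finally show ?thesis .
qed

text \<open>The negation of \<open>deep\<close> leaves coordinate 3 only at indices below \<open>\<epsilon> m\<close>.\<close>

definition deep :: "real \<Rightarrow> nat set \<Rightarrow> bool" where
  "deep \<epsilon> S \<longleftrightarrow> (\<exists>i. 0 < i \<and> i < mult S \<and>
     (4 \<le> kunz S i \<or> 3 \<le> kunz S i \<and> \<epsilon> * real (mult S) \<le> real i))"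

lemma deep_mem_deep_class:
  assumes S: "S \<in> semigroups_of_genus g" and "mult S = m" "deep \<epsilon> S"
  obtains q c a where "3 \<le> q" "q \<le> g" "0 < c" "c < m" "0 < a" "a \<le> m"
    "q = 3 \<longrightarrow> \<epsilon> * real m \<le> real c" "S \<in> deep_class g m q c a"
proof -
  have ns: "numerical_semigroup S" and g: "genus S = g" using S by (auto simp: semigroups_of_genus_def)
  let ?k = "kunz S" and ?I = "{0<..<m}"
  obtain i where i: "i \<in> ?I" "4 \<le> ?k i \<or> 3 \<le> ?k i \<and> \<epsilon> * real m \<le> real i"
    using assms by (auto simp: deep_def)
  define q where "q = Max (?k ` ?I)"
  have "?k ` ?I \<noteq> {}" using i by blast
  then have "q \<in> ?k ` ?I" unfolding q_def by (intro Max_in) auto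
  then have ne: "{c \<in> ?I. ?k c = q} \<noteq> {}" by auto
  define c where "c = Max {c \<in> ?I. ?k c = q}"
  have c: "c \<in> ?I" "?k c = q" using Max_in[of "{c \<in> ?I. ?k c = q}"] ne unfolding c_def by auto
  have le: "?k j \<le> q" if "j \<in> ?I" for j unfolding q_def using that by (intro Max_ge) auto
  have lt: "?k j \<le> q - 1" if "c < j" "j < m" for j
  proof -
    have "?k j \<noteq> q"
    proof
      assume "?k j = q"
      then have "j \<le> c" unfolding c_def using that by (intro Max_ge) auto
      then show False using that by simp
    qed
    then show ?thesis using le[of j] that by simp
  qed
  define a where "a = (LEAST a. 0 < a \<and> (a = m \<or> ?k a = 1))"
  have m: "0 < m" using i by auto
  then have a: "0 < a \<and> (a = m \<or> ?k a = 1)" unfolding a_def by (rule_tac LeastI[of _ m]) simp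
  have am: "a \<le> m" unfolding a_def using m by (intro Least_le) simp
  have ge: "2 \<le> ?k j" if "0 < j" "j < a" for j
  proof -
    have "\<not> (0 < j \<and> (j = m \<or> ?k j = 1))" using that(2) unfolding a_def by (rule not_less_Least)
    moreover have "1 \<le> ?k j" using kunz_pos[OF ns, of j] that am assms by simp
    ultimately show ?thesis using that by auto
  qed
  \<comment> \<open>With maximum 3 the witness \<open>i\<close> of depth has coordinate 3, so it is
    at most the last such index \<open>c\<close>.\<close>
  have "\<epsilon> * real m \<le> real c" if "q = 3"
  proof -
    have "?k i = 3" "\<epsilon> * real m \<le> real i" using i le[of i] that by auto
    moreover have "i \<le> c" unfolding c_def using i(1) that \<open>?k i = 3\<close> by (intro Max_ge) auto
    ultimately show ?thesis by linarith
  qed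
  moreover have "3 \<le> q" using i le[of i] by auto
  moreover have "q \<le> g" using kunz_le_genus[OF ns, of c] c g by simp
  moreover have "S \<in> deep_class g m q c a"
    using S assms(2) c le lt ge a by (auto simp: deep_class_def)
  ultimately show ?thesis using that c a am by auto
qed

text \<open>A union bound over at most \<open>(g + 1) ^ 3\<close> triples \<open>(q, c, a)\<close>,
  each contributing \<open>(g + 1) ^ 2\<close> from the middle coordinates.\<close>

lemma card_deep_le:
  assumes "0 \<le> \<epsilon>" "\<epsilon> \<le> 1" "m \<le> g + 1"
  shows "real (card {S \<in> semigroups_of_genus g. mult S = m \<and> deep \<epsilon> S}) * \<xi> ^ g
    \<le> 4 * (real g + 1) ^ 5 * rate powr (\<epsilon> * real m / 2)"
proof -
  let ?P = "{(q, c, a). q \<in> {3..g} \<and> c \<in> {0<..<m} \<and> a \<in> {0<..m} \<and> (q = 3 \<longrightarrow> \<epsilon> * real m \<le> real c)}"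
  let ?Q = "{..<g + 1} \<times> {..<g + 1} \<times> {0<..g + 1}"
  let ?D = "\<lambda>(q, c, a). deep_class g m q c a"
  have PQ: "?P \<subseteq> ?Q" using assms by auto
  then have finP: "finite ?P" by (rule finite_subset) auto
  have "{S \<in> semigroups_of_genus g. mult S = m \<and> deep \<epsilon> S} \<subseteq> (\<Union>p\<in>?P. ?D p)"
  proof
    fix S assume "S \<in> {S \<in> semigroups_of_genus g. mult S = m \<and> deep \<epsilon> S}"
    then have "S \<in> semigroups_of_genus g" "mult S = m" "deep \<epsilon> S" by auto
    then obtain q c a where "3 \<le> q" "q \<le> g" "0 < c" "c < m" "0 < a" "a \<le> m"
      "q = 3 \<longrightarrow> \<epsilon> * real m \<le> real c" "S \<in> deep_class g m q c a"
      by (rule deep_mem_deep_class)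
    then show "S \<in> (\<Union>p\<in>?P. ?D p)" by (intro UN_I[of "(q, c, a)"]) auto
  qed
  moreover have fin: "finite (?D p)" for p
    by (rule finite_subset[OF _ finite_semigroups_of_genus[of g]]) (auto simp: deep_class_def split: prod.splits)
  ultimately have "card {S \<in> semigroups_of_genus g. mult S = m \<and> deep \<epsilon> S} \<le> card (\<Union>p\<in>?P. ?D p)"
    using finP by (intro card_mono) auto
  also have "\<dots> \<le> (\<Sum>p\<in>?P. card (?D p))" by (rule card_UN_le[OF finP])
  finally have "real (card {S \<in> semigroups_of_genus g. mult S = m \<and> deep \<epsilon> S}) * \<xi> ^ g
      \<le> (\<Sum>p\<in>?P. real (card (?D p))) * \<xi> ^ g"
    by (intro mult_right_mono) (auto simp flip: of_nat_sum)
  also have "\<dots> = (\<Sum>p\<in>?P. real (card (?D p)) * \<xi> ^ g)" by (rule sum_distrib_right)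
  also have "\<dots> \<le> (\<Sum>p\<in>?P. 4 * rate powr (\<epsilon> * real m / 2) * (real g + 1) ^ 2)"
    by (intro sum_mono) (use assms in \<open>auto intro!: card_deep_class_le_rate\<close>)
  also have "\<dots> \<le> (\<Sum>p\<in>?Q. 4 * rate powr (\<epsilon> * real m / 2) * (real g + 1) ^ 2)"
    using PQ by (intro sum_mono2) auto
  also have "\<dots> = 4 * (real g + 1) ^ 5 * rate powr (\<epsilon> * real m / 2)"
    by (simp add: eval_nat_numeral algebra_simps)
  finally show ?thesis .
qed

section \<open>Small multiplicity and large deviations\<close>

definition kunz_list :: "nat set \<Rightarrow> nat list" where
  "kunz_list S = map (\<lambda>j. kunz S (j + 1)) [0..<mult S - 1]"

lemma inj_on_kunz_list:
  "inj_on kunz_list {S. numerical_semigroup S \<and> mult S = m}"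
proof (rule inj_onI)
  fix S T assume ST: "S \<in> {S. numerical_semigroup S \<and> mult S = m}"
    "T \<in> {S. numerical_semigroup S \<and> mult S = m}" and eq: "kunz_list S = kunz_list T"
  show "S = T"
  proof (rule kunz_inject)
    fix i assume i: "1 \<le> i" "i < mult S"
    then have "kunz_list S ! (i - 1) = kunz_list T ! (i - 1)" using eq by simp
    then show "kunz S i = kunz T i" using i ST by (simp add: kunz_list_def)
  qed (use ST in auto)
qed

text \<open>Exponential weights turn the count of a class of semigroups into a product over the residues.\<close>

lemma card_weighted_le:
  fixes w :: "nat \<Rightarrow> nat \<Rightarrow> real"
  assumes X: "X \<subseteq> {S \<in> semigroups_of_genus g. mult S = m}"
    and V: "\<And>S i. S \<in> X \<Longrightarrow> 0 < i \<Longrightarrow> i < m \<Longrightarrow> kunz S i \<in> V i"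
    and fin: "\<And>i. finite (V i)" and w: "\<And>i v. 0 \<le> w i v"
    and \<beta>: "\<And>i. 0 < i \<Longrightarrow> i < m \<Longrightarrow> (\<Sum>v\<in>V i. w i v) \<le> \<beta> i"
    and b: "\<And>S. S \<in> X \<Longrightarrow> b \<le> (\<Prod>i=1..<m. w i (kunz S i))"
  shows "real (card X) * b \<le> (\<Prod>i=1..<m. \<beta> i)"
proof -
  have shift: "(\<Prod>j<m - 1. f (j + 1)) = (\<Prod>i=1..<m. f i)" for f :: "nat \<Rightarrow> real"
    by (rule prod.reindex_bij_witness[of _ "\<lambda>i. i - 1" "\<lambda>j. j + 1"]) auto
  let ?L = "{xs. length xs = m - 1 \<and> (\<forall>j<m - 1. xs ! j \<in> V (j + 1))}"
  let ?W = "\<lambda>xs. \<Prod>j<m - 1. w (j + 1) (xs ! j)"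
  have m: "mult S = m" if "S \<in> X" for S using that X by auto
  have sub: "kunz_list ` X \<subseteq> ?L"
    using V m by (auto simp: kunz_list_def)
  have "?L = chains (Suc (m - 1)) (\<lambda>j. V (j + 1)) (\<lambda>_ _. True) (m - 1)"
    by (auto simp: chains_def)
  then have finL: "finite ?L" using finite_chains[of "Suc (m - 1)" "\<lambda>j. V (j + 1)"] fin by simp
  have W: "?W (kunz_list S) = (\<Prod>i=1..<m. w i (kunz S i))" if "S \<in> X" for S
  proof -
    have "?W (kunz_list S) = (\<Prod>j<m - 1. w (j + 1) (kunz S (j + 1)))"
      using m[OF that] by (intro prod.cong refl) (simp add: kunz_list_def)
    also have "\<dots> = (\<Prod>i=1..<m. w i (kunz S i))" by (rule shift)
    finally show ?thesis .
  qed
  have inj: "inj_on kunz_list X"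
    by (rule inj_on_subset[OF inj_on_kunz_list[of m]]) (use X in \<open>auto simp: semigroups_of_genus_def\<close>)
  have "real (card X) * b = (\<Sum>S\<in>X. b)" by simp
  also have "\<dots> \<le> (\<Sum>S\<in>X. ?W (kunz_list S))" using b W by (intro sum_mono) auto
  also have "\<dots> = sum ?W (kunz_list ` X)" using inj by (simp add: sum.reindex)
  also have "\<dots> \<le> sum ?W ?L" using sub finL w by (intro sum_mono2 prod_nonneg) auto
  also have "\<dots> \<le> (\<Prod>j<m - 1. \<beta> (j + 1))"
    by (rule sum_lists_prod_le) (use fin w \<beta> in auto)
  also have "\<dots> = (\<Prod>i=1..<m. \<beta> i)" by (rule shift)
  finally show ?thesis .
qed

text \<open>Weighting coordinates by powers of \<open>2 / 3\<close>, which exceeds \<xi>, makes each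
  residue contribute at most 2. With few residues the product \<open>2 ^ m\<close> is at most
  \<open>(26 / 25) ^ g\<close>.\<close>

lemma card_small_mult_le:
  assumes "20 * m \<le> g"
  shows "real (card {S \<in> semigroups_of_genus g. mult S = m}) * \<xi> ^ g \<le> (97 / 100) ^ g"
proof -
  let ?X = "{S \<in> semigroups_of_genus g. mult S = m}"
  have geo: "(\<Sum>v=1..g. (2 / 3 :: real) ^ v) \<le> 2"
  proof -
    have "(\<Sum>v=1..g. (2 / 3 :: real) ^ v) = 2 - 2 * (2 / 3) ^ g"
      by (induction g) (auto simp: field_simps)
    then show ?thesis by simp
  qed
  have "real (card ?X) * (2 / 3) ^ g \<le> (\<Prod>i=1..<m. 2)"
  proof (rule card_weighted_le[where V = "\<lambda>_. {1..g}" and w = "\<lambda>_ v. (2 / 3) ^ v" and g = g])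
    fix S assume S: "S \<in> ?X"
    then have ns: "numerical_semigroup S" and g: "genus S = g" and m: "mult S = m"
      by (auto simp: semigroups_of_genus_def)
    show "kunz S i \<in> {1..g}" if "0 < i" "i < m" for i
      using kunz_pos[OF ns, of i] kunz_le_genus[OF ns, of i] that g m by simp
    show "(2 / 3) ^ g \<le> (\<Prod>i=1..<m. (2 / 3 :: real) ^ kunz S i)"
      using sum_kunz[OF ns] g m by (simp flip: power_sum)
  qed (use geo in auto)
  also have "\<dots> \<le> (2 :: real) ^ m" by (simp add: power_increasing)
  also have "\<dots> \<le> ((26 / 25) ^ 20) ^ m" by (intro power_mono) (simp_all add: power_divide)
  also have "\<dots> = (26 / 25) ^ (20 * m)" by (simp add: power_mult)
  also have "\<dots> \<le> (26 / 25) ^ g" using assms by (intro power_increasing) auto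
  finally have "real (card ?X) * (2 / 3) ^ g \<le> (26 / 25) ^ g" .
  \<comment> \<open>The factor \<open>93 / 100\<close> lowers \<open>2 / 3\<close> to
    \<open>62 / 100\<close>, still above \<xi>, and \<open>26 / 25\<close> to a value below
    \<open>97 / 100\<close>.\<close>
  then have "real (card ?X) * (2 / 3) ^ g * (93 / 100) ^ g \<le> (26 / 25) ^ g * (93 / 100) ^ g"
    by (intro mult_right_mono) auto
  then have "real (card ?X) * (62 / 100) ^ g \<le> (2418 / 2500) ^ g"
    by (simp add: mult.assoc flip: power_mult_distrib)
  moreover have "\<xi> ^ g \<le> (62 / 100) ^ g" using \<xi>_bounds by (intro power_mono) auto
  then have "real (card ?X) * \<xi> ^ g \<le> real (card ?X) * (62 / 100) ^ g" by (intro mult_left_mono) auto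
  moreover have "(2418 / 2500) ^ g \<le> (97 / 100 :: real) ^ g" by (intro power_mono) auto
  ultimately show ?thesis by linarith
qed

section \<open>Exponential moments and the Chernoff bound\<close>

text \<open>For negative \<open>y\<close>, combine \<open>1 - y \<le> exp (- y)\<close> with
  \<open>(1 - y) * (1 + y + y ^ 2) = 1 - y ^ 3 \<ge> 1\<close>.\<close>

lemma exp_le_quadratic:
  fixes y :: real
  assumes "\<bar>y\<bar> \<le> 1"
  shows "exp y \<le> 1 + y + y\<^sup>2"
proof (cases "0 \<le> y")
  case True
  then show ?thesis using assms by (intro exp_bound) auto
next
  case False
  have "1 \<le> (1 - y) * (1 + y + y\<^sup>2)"
  proof -
    have "y ^ 3 \<le> 0" using False by (simp add: power_le_zero_eq)
    moreover have "(1 - y) * (1 + y + y\<^sup>2) = 1 - y ^ 3" by (simp add: power2_eq_square power3_eq_cube algebra_simps)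
    ultimately show ?thesis by simp
  qed
  also have "\<dots> \<le> exp (- y) * (1 + y + y\<^sup>2)"
  proof (rule mult_right_mono)
    show "1 - y \<le> exp (- y)" using exp_ge_add_one_self[of "- y"] by simp
    show "0 \<le> 1 + y + y\<^sup>2" using assms by (simp add: abs_le_iff)
  qed
  finally show ?thesis by (simp add: exp_minus field_simps)
qed

text \<open>The mean \<open>\<xi> + 2 \<xi>\<^sup>2\<close> of a Kunz coordinate with law \<open>P(1) = \<xi>\<close>, \<open>P(2) = \<xi>\<^sup>2\<close>.\<close>

definition \<mu> :: real where "\<mu> = 2 - \<xi>"

text \<open>The linear term vanishes because \<mu> is the mean, and the variance is at most 1. With
  coordinate 3 allowed the total mass is \<open>2 * \<xi>\<close>, and a crude bound suffices for
  the few such indices.\<close>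

lemma tilted_sum_le:
  assumes "\<bar>r\<bar> \<le> 1 / 2"
  shows "(\<Sum>v\<in>{1, 2}. \<xi> ^ v * exp (r * (real v - \<mu>))) \<le> exp (r\<^sup>2)"
    and "(\<Sum>v\<in>{1, 2, 3}. \<xi> ^ v * exp (r * (real v - \<mu>))) \<le> exp 2"
proof -
  have small: "\<bar>r * d\<bar> \<le> 1" if "\<bar>d\<bar> \<le> 2" for d
  proof -
    have "\<bar>r\<bar> * \<bar>d\<bar> \<le> 1 / 2 * 2" using assms that by (intro mult_mono) auto
    then show ?thesis by (simp add: abs_mult)
  qed
  have d: "\<bar>1 - \<mu>\<bar> \<le> 2" "\<bar>2 - \<mu>\<bar> \<le> 2" "\<bar>3 - \<mu>\<bar> \<le> 2"
    using \<xi>_bounds by (auto simp: \<mu>_def)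
  have "(\<Sum>v\<in>{1, 2}. \<xi> ^ v * exp (r * (real v - \<mu>))) =
      \<xi> * exp (r * (1 - \<mu>)) + (1 - \<xi>) * exp (r * (2 - \<mu>))"
    by (simp add: \<xi>_square)
  also have "\<dots> \<le> \<xi> * (1 + r * (1 - \<mu>) + (r * (1 - \<mu>))\<^sup>2) +
      (1 - \<xi>) * (1 + r * (2 - \<mu>) + (r * (2 - \<mu>))\<^sup>2)"
    using small d by (intro add_mono mult_left_mono exp_le_quadratic) auto
  also have "\<dots> = 1 + r * (\<xi> + 2 * (1 - \<xi>) - \<mu>) + r\<^sup>2 * (\<xi> * (1 - \<mu>)\<^sup>2 + (1 - \<xi>) * (2 - \<mu>)\<^sup>2)"
    by (simp add: power2_eq_square algebra_simps)
  also have "\<dots> \<le> 1 + r\<^sup>2 * 1"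
  proof -
    have "(1 - \<mu>)\<^sup>2 \<le> 1" "(2 - \<mu>)\<^sup>2 \<le> 1"
      using \<xi>_bounds by (auto simp: \<mu>_def abs_le_iff simp flip: abs_le_square_iff[of _ 1, simplified])
    then have "\<xi> * (1 - \<mu>)\<^sup>2 + (1 - \<xi>) * (2 - \<mu>)\<^sup>2 \<le> \<xi> * 1 + (1 - \<xi>) * 1"
      by (intro add_mono mult_left_mono) auto
    then have "r\<^sup>2 * (\<xi> * (1 - \<mu>)\<^sup>2 + (1 - \<xi>) * (2 - \<mu>)\<^sup>2) \<le> r\<^sup>2 * 1"
      by (intro mult_left_mono) auto
    then show ?thesis by (simp add: \<mu>_def)
  qed
  also have "\<dots> \<le> exp (r\<^sup>2)" using exp_ge_add_one_self[of "r\<^sup>2"] by simp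
  finally show "(\<Sum>v\<in>{1, 2}. \<xi> ^ v * exp (r * (real v - \<mu>))) \<le> exp (r\<^sup>2)" .
  have "exp (r * (real v - \<mu>)) \<le> exp 1" if "v \<in> {1, 2, 3}" for v
    using small[of "real v - \<mu>"] d that by auto
  then have "(\<Sum>v\<in>{1, 2, 3}. \<xi> ^ v * exp (r * (real v - \<mu>))) \<le> (\<Sum>v\<in>{1, 2, 3}. \<xi> ^ v * exp 1)"
    by (intro sum_mono mult_left_mono) auto
  also have "\<dots> = 2 * \<xi> * exp 1" by (simp add: \<xi>_square \<xi>_cube algebra_simps)
  also have "\<dots> \<le> exp 1 * exp 1"
    using \<xi>_bounds exp_ge_add_one_self[of 1] by (intro mult_right_mono) auto
  also have "\<dots> = exp 2" by (simp flip: exp_add)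
  finally show "(\<Sum>v\<in>{1, 2, 3}. \<xi> ^ v * exp (r * (real v - \<mu>))) \<le> exp 2" .
qed

text \<open>Chernoff bound with tilt \<open>t = \<eta> / 2\<close>. At most
  \<open>\<epsilon> * m\<close> indices may have coordinate 3 and cost 2 more in the exponent, so
  the exponent per unit of \<open>m\<close> is
  \<open>2 * \<epsilon> + t ^ 2 - t * \<eta> = - \<eta> ^ 2 / 8\<close>.\<close>

lemma card_deviating_le:
  fixes u :: "nat \<Rightarrow> real"
  assumes u: "\<And>i. i < m \<Longrightarrow> \<bar>u i\<bar> \<le> 1" and \<eta>: "0 < \<eta>" "\<eta> \<le> 1"
  shows "real (card {S \<in> semigroups_of_genus g. mult S = m \<and> \<not> deep (\<eta>\<^sup>2 / 16) S \<and>
      \<eta> * real m < (\<Sum>i=1..<m. u i * (real (kunz S i) - \<mu>))}) * \<xi> ^ g \<le> exp (- (\<eta>\<^sup>2 * real m / 8))"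
    (is "real (card ?X) * _ \<le> _")
proof -
  define \<epsilon> t where "\<epsilon> = \<eta>\<^sup>2 / 16" and "t = \<eta> / 2"
  have tu: "\<bar>t * u i\<bar> \<le> 1 / 2" "(t * u i)\<^sup>2 \<le> t\<^sup>2" if "i < m" for i
  proof -
    have "\<bar>t\<bar> * \<bar>u i\<bar> \<le> \<bar>t\<bar> * 1" using u[OF that] by (intro mult_left_mono) auto
    then have "\<bar>t * u i\<bar> \<le> \<bar>t\<bar>" by (simp add: abs_mult)
    then show "(t * u i)\<^sup>2 \<le> t\<^sup>2" by (simp add: abs_le_square_iff)
    show "\<bar>t * u i\<bar> \<le> 1 / 2" using \<open>\<bar>t * u i\<bar> \<le> \<bar>t\<bar>\<close> \<eta> by (simp add: t_def)
  qed
  let ?V = "\<lambda>i. if real i < \<epsilon> * real m then {1, 2, 3} else {1, 2 :: nat}"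
  let ?\<beta> = "\<lambda>i. exp ((if real i < \<epsilon> * real m then 2 else 0) + t\<^sup>2)"
  have "real (card ?X) * (\<xi> ^ g * exp (t * (\<eta> * real m))) \<le> (\<Prod>i=1..<m. ?\<beta> i)"
  proof (rule card_weighted_le[where V = ?V and g = g and
        w = "\<lambda>i v. \<xi> ^ v * exp (t * u i * (real v - \<mu>))"])
    fix S assume S: "S \<in> ?X"
    then have ns: "numerical_semigroup S" and g: "genus S = g" and m: "mult S = m"
      by (auto simp: semigroups_of_genus_def)
    show "kunz S i \<in> ?V i" if "0 < i" "i < m" for i
    proof -
      have "1 \<le> kunz S i" using kunz_pos[OF ns] that m by simp
      moreover have "kunz S i < 4 \<and> (\<epsilon> * real m \<le> real i \<longrightarrow> kunz S i < 3)"
        using S that m by (auto simp: deep_def \<epsilon>_def not_le)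
      ultimately show ?thesis by auto
    qed
    have "\<xi> ^ g * exp (t * (\<eta> * real m)) \<le>
        \<xi> ^ (\<Sum>i=1..<m. kunz S i) * exp (t * (\<Sum>i=1..<m. u i * (real (kunz S i) - \<mu>)))"
      using S sum_kunz[OF ns] m g \<eta> by (intro mult_mono) (auto simp: t_def)
    also have "\<dots> = (\<Prod>i=1..<m. \<xi> ^ kunz S i * exp (t * u i * (real (kunz S i) - \<mu>)))"
      by (simp add: power_sum prod.distrib sum_distrib_left exp_sum mult.assoc)
    finally show "\<xi> ^ g * exp (t * (\<eta> * real m)) \<le>
        (\<Prod>i=1..<m. \<xi> ^ kunz S i * exp (t * u i * (real (kunz S i) - \<mu>)))" .
  next
    fix i assume i: "0 < i" "i < m"
    show "(\<Sum>v\<in>?V i. \<xi> ^ v * exp (t * u i * (real v - \<mu>))) \<le> ?\<beta> i"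
    proof (cases "real i < \<epsilon> * real m")
      case True
      have "exp 2 \<le> exp (2 + t\<^sup>2)" by simp
      then show ?thesis using tilted_sum_le(2)[OF tu(1)[OF i(2)]] True by (simp only: if_True)
    next
      case False
      have "exp ((t * u i)\<^sup>2) \<le> exp (t\<^sup>2)" using tu(2)[OF i(2)] by simp
      then show ?thesis using tilted_sum_le(1)[OF tu(1)[OF i(2)]] False by (simp only: if_False add_0)
    qed
  qed auto
  also have "\<dots> = exp (\<Sum>i=1..<m. (if real i < \<epsilon> * real m then 2 else 0) + t\<^sup>2)"
    by (simp add: exp_sum)
  also have "\<dots> \<le> exp (2 * (\<epsilon> * real m) + t\<^sup>2 * real m)"
  proof -
    have "(\<Sum>i=1..<m. if real i < \<epsilon> * real m then 2 else (0::real)) =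
        2 * real (card {i \<in> {1..<m}. real i < \<epsilon> * real m})"
      by (simp flip: sum.inter_filter)
    also have "\<dots> \<le> 2 * (\<epsilon> * real m)"
    proof -
      have "{i \<in> {1..<m}. real i < \<epsilon> * real m} \<subseteq> {1..nat \<lfloor>\<epsilon> * real m\<rfloor>}"
        by (auto simp: le_nat_floor)
      then have "card {i \<in> {1..<m}. real i < \<epsilon> * real m} \<le> nat \<lfloor>\<epsilon> * real m\<rfloor>"
        using card_mono[of "{1..nat \<lfloor>\<epsilon> * real m\<rfloor>}"] by fastforce
      moreover have "0 \<le> \<epsilon> * real m" by (simp add: \<epsilon>_def)
      ultimately show ?thesis by linarith
    qed
    moreover have "(\<Sum>i=1..<m. t\<^sup>2) \<le> t\<^sup>2 * real m"
      by (simp add: mult_right_mono mult.commute)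
    ultimately show ?thesis by (simp add: sum.distrib)
  qed
  finally have "real (card ?X) * \<xi> ^ g * exp (t * (\<eta> * real m)) \<le> exp (2 * (\<epsilon> * real m) + t\<^sup>2 * real m)"
    by (simp add: mult.assoc)
  then have "real (card ?X) * \<xi> ^ g \<le> exp (2 * (\<epsilon> * real m) + t\<^sup>2 * real m) / exp (t * (\<eta> * real m))"
    by (simp add: pos_le_divide_eq)
  also have "\<dots> = exp (- (\<eta>\<^sup>2 * real m / 8))"
    by (simp add: \<epsilon>_def t_def power2_eq_square flip: exp_diff)
  finally show ?thesis .
qed

section \<open>Counting from below, and the typical weight\<close>

text \<open>Sums of two nonzero elements are at least \<open>2 * m\<close>, beyond all gaps.
  \<open>B\<close> is the set of indices with coordinate 2.\<close>

lemma ordinary_depth_two_semigroup: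
  fixes m :: nat and B
  assumes B: "B \<subseteq> {1..<m}" and m: "0 < m"
  defines "S \<equiv> insert 0 ({m..} - (+) m ` B)"
  shows "S \<in> semigroups_of_genus (m - 1 + card B)"
proof -
  have gaps: "gaps S = {1..<m} \<union> (+) m ` B"
    using B m by (auto simp: gaps_def S_def)
  have finB: "finite B" using B finite_subset by auto
  have "x + y \<in> S" if "x \<in> S" "y \<in> S" for x y
  proof (cases "x = 0 \<or> y = 0")
    case False
    then have "2 * m \<le> x + y" using that by (auto simp: S_def)
    then show ?thesis using B by (auto simp: S_def)
  qed (use that in auto)
  moreover have "finite (- S)" using gaps finB by (simp add: gaps_def)
  ultimately have "numerical_semigroup S" by (simp add: numerical_semigroup_def S_def)
  moreover have "card (gaps S) = m - 1 + card B"
    unfolding gaps using finB B by (subst card_Un_disjoint) (auto simp: card_image)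
  ultimately show ?thesis by (simp add: semigroups_of_genus_def genus_def)
qed

text \<open>With \<open>k\<close> coordinates equal to 2 the multiplicity is
  \<open>g - k + 1\<close>, which leaves \<open>(g - k) choose k\<close> semigroups; these binomials
  sum to a Fibonacci number.\<close>

lemma fib_le_card_semigroups_of_genus: "fib (Suc g) \<le> card (semigroups_of_genus g)"
proof -
  let ?F = "\<lambda>k. {B. B \<subseteq> {1..g - k} \<and> card B = k}"
  let ?S = "\<lambda>B. insert 0 ({g - card B + 1..} - (+) (g - card B + 1) ` B)"
  have fin: "finite (?F k)" for k by (rule finite_subset[of _ "Pow {1..g - k}"]) auto
  have le: "card B \<le> g" if "B \<in> (\<Union>k\<le>g. ?F k)" for B using that by auto
  have sub: "B \<subseteq> {1..<g - card B + 1}" if "B \<in> (\<Union>k\<le>g. ?F k)" for B using that by fastforce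
  have "fib (Suc g) = (\<Sum>k=0..g. (g - k) choose k)" by (rule ne_diagonal_fib[symmetric])
  also have "\<dots> = (\<Sum>k\<le>g. card (?F k))"
    by (intro sum.cong) (auto simp: n_subsets atMost_atLeast0)
  also have "\<dots> = card (\<Union>k\<le>g. ?F k)"
    using fin by (intro card_UN_disjoint[symmetric]) auto
  also have "\<dots> \<le> card (semigroups_of_genus g)"
  proof (rule card_inj_on_le[of ?S])
    show "?S ` (\<Union>k\<le>g. ?F k) \<subseteq> semigroups_of_genus g"
    proof (rule image_subsetI)
      fix B assume B: "B \<in> (\<Union>k\<le>g. ?F k)"
      show "?S B \<in> semigroups_of_genus g"
        using ordinary_depth_two_semigroup[OF sub[OF B]] le[OF B] by simp
    qed
    show "inj_on ?S (\<Union>k\<le>g. ?F k)"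
    proof (rule inj_onI)
      fix B C assume BC: "B \<in> (\<Union>k\<le>g. ?F k)" "C \<in> (\<Union>k\<le>g. ?F k)" and eq: "?S B = ?S C"
      have mem: "n \<in> ?S A \<longleftrightarrow> n = 0 \<or> g - card A + 1 \<le> n \<and> n - (g - card A + 1) \<notin> A"
        if "A \<in> (\<Union>k\<le>g. ?F k)" for A n
        by (auto simp: image_iff)
      have least: "g - card A + 1 \<in> ?S A" if "A \<in> (\<Union>k\<le>g. ?F k)" for A
        unfolding mem[OF that] using sub[OF that] by auto
      \<comment> \<open>The least nonzero element of the semigroup is its multiplicity, so equal
        images force equal cardinalities of \<open>B\<close> and \<open>C\<close>.\<close>
      have "g - card C + 1 \<le> g - card B + 1" using least[OF BC(1)] unfolding eq mem[OF BC(2)] by simp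
      moreover have "g - card B + 1 \<le> g - card C + 1"
        using least[OF BC(2)] unfolding eq[symmetric] mem[OF BC(1)] by simp
      ultimately have m: "g - card B + 1 = g - card C + 1" by simp
      have "b \<in> B \<longleftrightarrow> b \<in> C" for b
      proof -
        have "(g - card B + 1) + b \<in> ?S B \<longleftrightarrow> (g - card B + 1) + b \<in> ?S C" by (simp only: eq)
        then show ?thesis unfolding mem[OF BC(1)] mem[OF BC(2)] unfolding m by simp
      qed
      then show "B = C" by blast
    qed
  qed (rule finite_semigroups_of_genus)
  finally show ?thesis .
qed

text \<open>The Fibonacci recursion matches
  \<open>\<xi> = \<xi> * \<xi> + \<xi> ^ 2 * \<xi>\<close>; equality holds at
  \<open>n = 1\<close>.\<close>

lemma fib_lower_bound: "\<xi> \<le> real (fib (Suc n)) * \<xi> ^ n"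
proof (induction n rule: fib.induct)
  case (3 n)
  have "\<xi> = \<xi> * \<xi> + \<xi>\<^sup>2 * \<xi>"
    by (simp add: \<xi>_square algebra_simps flip: power2_eq_square)
  also have "\<dots> \<le> \<xi> * (real (fib (Suc (Suc n))) * \<xi> ^ Suc n) + \<xi>\<^sup>2 * (real (fib (Suc n)) * \<xi> ^ n)"
    using 3 by (intro add_mono mult_left_mono) auto
  also have "\<dots> = real (fib (Suc (Suc (Suc n)))) * \<xi> ^ Suc (Suc n)"
    by (simp add: power2_eq_square algebra_simps)
  finally show ?case .
qed auto

lemma card_semigroups_lower_bound: "\<xi> \<le> real (card (semigroups_of_genus g)) * \<xi> ^ g"
proof -
  have "real (fib (Suc g)) * \<xi> ^ g \<le> real (card (semigroups_of_genus g)) * \<xi> ^ g"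
    using fib_le_card_semigroups_of_genus by (intro mult_right_mono) auto
  then show ?thesis using fib_lower_bound[of g] by linarith
qed

section \<open>The weight as a polynomial in multiplicity and genus\<close>

lemma weight_eq_kunz:
  assumes S: "S \<in> semigroups_of_genus g" and m: "mult S = m"
  shows "weight S = (\<Sum>i=1..<m. real i * real (kunz S i)) +
    real m * (\<Sum>i=1..<m. real (kunz S i) * (real (kunz S i) - 1) / 2) - real g * (real g + 1) / 2"
proof -
  have ns: "numerical_semigroup S" and g: "genus S = g" using S by (auto simp: semigroups_of_genus_def)
  have inner: "(\<Sum>t<n. real (i + t * m)) = real i * real n + real m * (real n * (real n - 1) / 2)" for i n :: nat
    by (induction n) (auto simp: field_simps)
  have "(\<Sum>x\<in>gaps S. real x) = (\<Sum>i=1..<m. \<Sum>t<kunz S i. real (i + t * m))"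
    using sum_gaps_eq[OF ns, of real] m by simp
  also have "\<dots> = (\<Sum>i=1..<m. real i * real (kunz S i)) +
      real m * (\<Sum>i=1..<m. real (kunz S i) * (real (kunz S i) - 1) / 2)"
    unfolding inner by (simp add: sum.distrib sum_distrib_left)
  finally show ?thesis unfolding weight_def g by simp
qed

text \<open>Without depth, \<open>k * (k - 1) / 2\<close> is \<open>k - 1\<close>, plus 1 where
  \<open>k = 3\<close>, so the weight is a quadratic in \<open>m\<close> and \<open>g\<close> up to
  the deviation \<open>D\<close> and the number \<open>T\<close> of coordinates 3. Substituting
  \<open>g = \<mu> * m + h\<close> cancels the main term.\<close>

lemma weight_estimate:
  assumes S: "S \<in> semigroups_of_genus g" and m: "mult S = m" and shallow: "\<not> deep \<epsilon> S"
    and \<epsilon>: "0 \<le> \<epsilon>" "\<epsilon> \<le> \<eta>" and \<eta>: "\<eta> \<le> 1" and g: "1 \<le> g"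
    and dev1: "\<bar>\<Sum>i=1..<m. real (kunz S i) - \<mu>\<bar> \<le> \<eta> * real m"
    and dev2: "\<bar>\<Sum>i=1..<m. real i / real m * (real (kunz S i) - \<mu>)\<bar> \<le> \<eta> * real m"
  shows "\<bar>weight S - \<xi> / 10 * (real g)\<^sup>2\<bar> \<le> 24 * \<eta> * (real g)\<^sup>2 + 40 * real g"
proof -
  have ns: "numerical_semigroup S" and gS: "genus S = g" using S by (auto simp: semigroups_of_genus_def)
  have mpos: "0 < m" using mult_mem_pos[OF ns] m by simp
  have mg: "real m \<le> 2 * real g" using mult_le_genus[OF ns] m gS g by linarith
  let ?k = "\<lambda>i. real (kunz S i)"
  define T where "T = real (card {i \<in> {1..<m}. kunz S i = 3})"
  have T: "0 \<le> T" "T \<le> \<epsilon> * real m"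
  proof -
    have "{i \<in> {1..<m}. kunz S i = 3} \<subseteq> {1..nat \<lfloor>\<epsilon> * real m\<rfloor>}"
    proof
      fix i assume i: "i \<in> {i \<in> {1..<m}. kunz S i = 3}"
      then have "real i < \<epsilon> * real m" using shallow m by (force simp: deep_def not_le)
      then show "i \<in> {1..nat \<lfloor>\<epsilon> * real m\<rfloor>}" using i by (simp add: le_nat_floor)
    qed
    then have "card {i \<in> {1..<m}. kunz S i = 3} \<le> nat \<lfloor>\<epsilon> * real m\<rfloor>"
      using card_mono[of "{1..nat \<lfloor>\<epsilon> * real m\<rfloor>}"] by fastforce
    moreover have "0 \<le> \<epsilon> * real m" using \<epsilon> by simp
    ultimately show "T \<le> \<epsilon> * real m" unfolding T_def by linarith
  qed (simp add: T_def)
  have m1: "real (m - 1) = real m - 1" using mpos by (simp add: of_nat_diff)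
  have sumk: "(\<Sum>i=1..<m. ?k i) = real g" using sum_kunz[OF ns] m gS by (simp flip: of_nat_sum)
  have "(\<Sum>i=1..<m. ?k i * (?k i - 1) / 2) = (\<Sum>i=1..<m. (?k i - 1) + (if kunz S i = 3 then 1 else 0))"
  proof (rule sum.cong[OF refl])
    fix i assume i: "i \<in> {1..<m}"
    then have "1 \<le> kunz S i" "kunz S i < 4" using kunz_pos[OF ns] shallow m by (auto simp: deep_def not_le)
    then have "kunz S i = 1 \<or> kunz S i = 2 \<or> kunz S i = 3" by linarith
    then show "?k i * (?k i - 1) / 2 = (?k i - 1) + (if kunz S i = 3 then 1 else 0)" by auto
  qed
  also have "\<dots> = real g - (real m - 1) + T"
    using m1 by (simp add: sum.distrib sum_subtractf sumk T_def del: One_nat_def flip: sum.inter_filter)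
  finally have tri: "(\<Sum>i=1..<m. ?k i * (?k i - 1) / 2) = real g - (real m - 1) + T" .
  define D where "D = (\<Sum>i=1..<m. real i / real m * (?k i - \<mu>))"
  have gauss: "(\<Sum>i=1..<m. real i) = real m * (real m - 1) / 2"
    using mpos by (induction m rule: nat_induct_non_zero) (auto simp: field_simps)
  have "real m * D = (\<Sum>i=1..<m. real i * ?k i - \<mu> * real i)"
    unfolding D_def sum_distrib_left using mpos by (intro sum.cong) (auto simp: field_simps)
  also have "\<dots> = (\<Sum>i=1..<m. real i * ?k i) - \<mu> * (real m * (real m - 1) / 2)"
    unfolding sum_subtractf gauss[symmetric] sum_distrib_left ..
  finally have lin: "(\<Sum>i=1..<m. real i * ?k i) = real m * D + \<mu> * (real m * (real m - 1) / 2)" by simp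
  define h where "h = real g - \<mu> * real m"
  have w: "weight S - \<xi> / 10 * (real g)\<^sup>2 = real m * h - (1 / 2 + \<xi> / 10) * (2 * \<mu> * (real m * h) + h\<^sup>2)
      + real m * D + real m * T + (real m - \<mu> * real m / 2 - real g / 2)"
  proof -
    have "weight S - \<xi> / 10 * (real g)\<^sup>2 = real m * D + \<mu> * (real m * (real m - 1) / 2)
        + real m * (real g - (real m - 1) + T) - real g * (real g + 1) / 2 - \<xi> / 10 * (real g)\<^sup>2"
      unfolding weight_eq_kunz[OF S m] lin tri ..
    also have "\<dots> = ((3 / 2) * \<mu> - 1 - (1 / 2 + \<xi> / 10) * \<mu>\<^sup>2) * (real m)\<^sup>2
      + (real m * h - (1 / 2 + \<xi> / 10) * (2 * \<mu> * (real m * h) + h\<^sup>2)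
      + real m * D + real m * T + (real m - \<mu> * real m / 2 - real g / 2))"
    proof -
      have gh: "real g = \<mu> * real m + h" by (simp add: h_def)
      show ?thesis unfolding gh by (simp add: power2_eq_square field_simps)
    qed
    \<comment> \<open>This identity, a consequence of \<open>\<xi> ^ 2 = 1 - \<xi>\<close>, fixes
      the limiting constant \<open>\<xi> / 10\<close>.\<close>
    also have "(3 / 2) * \<mu> - 1 - (1 / 2 + \<xi> / 10) * \<mu>\<^sup>2 = 0"
    proof -
      have sq: "\<xi> * \<xi> = 1 - \<xi>" using \<xi>_square by (simp add: power2_eq_square)
      have *: "\<mu>\<^sup>2 = 5 - 5 * \<xi>" unfolding \<mu>_def by (simp add: power2_eq_square algebra_simps sq)
      show ?thesis unfolding * unfolding \<mu>_def by (simp add: algebra_simps sq) (simp add: field_simps)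
    qed
    finally show ?thesis by simp
  qed
  have \<mu>: "1 \<le> \<mu>" "\<mu> \<le> 7 / 5" using \<xi>_bounds by (auto simp: \<mu>_def)
  have "real g - \<mu> * (real m - 1) = (\<Sum>i=1..<m. ?k i - \<mu>)"
    using m1 by (simp add: sum_subtractf sumk del: One_nat_def)
  then have "\<bar>h + \<mu>\<bar> \<le> \<eta> * real m" using dev1 by (simp add: h_def algebra_simps)
  then have h: "\<bar>h\<bar> \<le> \<eta> * real m + 2" using \<mu> by linarith
  define M where "M = real m"
  have M: "1 \<le> M" "M \<le> 2 * real g" using mpos mg by (auto simp: M_def)
  have \<eta>0: "0 \<le> \<eta>" using \<epsilon> by linarith
  have eM: "\<eta> * M \<le> M" using \<eta> M by (simp add: mult_left_le_one_le \<eta>0)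
  have mh: "M * \<bar>h\<bar> \<le> \<eta> * M\<^sup>2 + 2 * M"
    using mult_left_mono[OF h, of M] M by (simp add: M_def power2_eq_square algebra_simps)
  have h2: "h\<^sup>2 \<le> \<eta> * M\<^sup>2 + 8 * M"
  proof -
    have "h\<^sup>2 = \<bar>h\<bar> * \<bar>h\<bar>" by (simp add: power2_eq_square)
    also have "\<dots> \<le> (\<eta> * M + 2) * (\<eta> * M + 2)" using h \<eta>0 M by (intro mult_mono) (auto simp: M_def)
    also have "\<dots> = \<eta> * (M * (\<eta> * M)) + 4 * (\<eta> * M) + 4" by (simp add: algebra_simps)
    also have "\<dots> \<le> \<eta> * (M * M) + 4 * M + 4 * M"
      using eM M \<eta>0 by (intro add_mono mult_left_mono) auto
    finally show ?thesis by (simp add: power2_eq_square)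
  qed
  have D: "\<bar>M * D\<bar> \<le> \<eta> * M\<^sup>2"
    using mult_left_mono[OF dev2, of M] M by (simp add: D_def M_def abs_mult power2_eq_square algebra_simps)
  have MT: "0 \<le> M * T" "M * T \<le> \<eta> * M\<^sup>2"
  proof -
    have "\<epsilon> * M \<le> \<eta> * M" using \<epsilon>(2) M by (intro mult_right_mono) auto
    then have "T \<le> \<eta> * M" using T(2) unfolding M_def by linarith
    then show "M * T \<le> \<eta> * M\<^sup>2" using mult_left_mono[of T "\<eta> * M" M] M by (simp add: power2_eq_square algebra_simps)
  qed (use T M in simp)
  have coef: "\<bar>(1 / 2 + \<xi> / 10) * (2 * \<mu> * (M * h) + h\<^sup>2)\<bar> \<le> 3 / 5 * (14 / 5 * (M * \<bar>h\<bar>) + h\<^sup>2)"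
  proof -
    have "\<bar>2 * \<mu> * (M * h) + h\<^sup>2\<bar> \<le> 2 * \<mu> * (M * \<bar>h\<bar>) + h\<^sup>2"
      using abs_triangle_ineq[of "2 * \<mu> * (M * h)" "h\<^sup>2"] \<mu> M by (simp add: abs_mult)
    also have "\<dots> \<le> 14 / 5 * (M * \<bar>h\<bar>) + h\<^sup>2"
      using \<mu> M by (intro add_right_mono mult_right_mono) auto
    finally have "\<bar>2 * \<mu> * (M * h) + h\<^sup>2\<bar> \<le> 14 / 5 * (M * \<bar>h\<bar>) + h\<^sup>2" .
    moreover have "\<bar>1 / 2 + \<xi> / 10\<bar> \<le> 3 / 5" using \<xi>_bounds by simp
    ultimately show ?thesis unfolding abs_mult by (intro mult_mono) auto
  qed
  have "\<bar>M * h\<bar> = M * \<bar>h\<bar>" using M by (simp add: abs_mult)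
  moreover have "\<bar>M - \<mu> * M / 2 - real g / 2\<bar> \<le> M + real g"
  proof -
    have "0 \<le> \<mu> * M" "\<mu> * M \<le> 7 / 5 * M" using \<mu> M by (auto intro: mult_right_mono)
    then show ?thesis using M by linarith
  qed
  ultimately have "\<bar>weight S - \<xi> / 10 * (real g)\<^sup>2\<bar> \<le>
      (M * \<bar>h\<bar>) + 3 / 5 * (14 / 5 * (M * \<bar>h\<bar>) + h\<^sup>2) + \<eta> * M\<^sup>2 + \<eta> * M\<^sup>2 + (M + real g)"
    unfolding w using coef D MT unfolding M_def by linarith
  \<comment> \<open>The coefficients of \<open>\<eta> * M ^ 2\<close> add up to \<open>5.28\<close>.
    With \<open>M \<le> 2 * g\<close> the bound 6 becomes 24, and the linear terms stay below
    \<open>40 * g\<close>.\<close>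
  also have "\<dots> \<le> 6 * (\<eta> * M\<^sup>2) + 40 * real g"
  proof -
    have "0 \<le> \<eta> * M\<^sup>2" using \<eta>0 by simp
    then show ?thesis using mh h2 M unfolding distrib_left by linarith
  qed
  also have "\<eta> * M\<^sup>2 \<le> \<eta> * (2 * real g)\<^sup>2"
    using M \<eta>0 by (intro mult_left_mono power_mono) auto
  finally show ?thesis by simp
qed

section \<open>Concentration\<close>

definition atypical :: "real \<Rightarrow> nat \<Rightarrow> nat set set" where
  "atypical \<eta> g = {S \<in> semigroups_of_genus g.
     24 * \<eta> * (real g)\<^sup>2 + 40 * real g < \<bar>weight S - \<xi> / 10 * (real g)\<^sup>2\<bar>}"

text \<open>By \<open>weight_estimate\<close> an atypical semigroup is deep or deviates for one of
  the four choices \<open>1\<close>, \<open>- 1\<close>, \<open>i / m\<close>,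
  \<open>- i / m\<close> of \<open>u i\<close>. The bound \<open>g < 20 * m\<close> turns decay in
  \<open>m\<close> into decay in \<open>g\<close>, whence \<open>640 = 16 * 2 * 20\<close> and
  \<open>160 = 8 * 20\<close>.\<close>

lemma card_atypical_mult_le:
  assumes \<eta>: "0 < \<eta>" "\<eta> \<le> 1" and m: "m \<le> g + 1" "g < 20 * m" and g: "1 \<le> g"
  shows "real (card {S \<in> atypical \<eta> g. mult S = m}) * \<xi> ^ g \<le>
    4 * (real g + 1) ^ 5 * rate powr (\<eta>\<^sup>2 * real g / 640) + 4 * exp (- (\<eta>\<^sup>2 * real g / 160))"
proof -
  define \<epsilon> where "\<epsilon> = \<eta>\<^sup>2 / 16"
  have "\<eta>\<^sup>2 \<le> \<eta>" using \<eta> by (simp add: power2_eq_square mult_left_le)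
  then have \<epsilon>: "0 \<le> \<epsilon>" "\<epsilon> \<le> \<eta>" "\<epsilon> \<le> 1" using \<eta> by (auto simp: \<epsilon>_def)
  let ?S = "\<lambda>P. {S \<in> semigroups_of_genus g. mult S = m \<and> P S}"
  let ?dev = "\<lambda>u. ?S (\<lambda>S. \<not> deep \<epsilon> S \<and> \<eta> * real m < (\<Sum>i=1..<m. u i * (real (kunz S i) - \<mu>)))"
  let ?u = "\<lambda>i. real i / real m"
  let ?A = "{S \<in> atypical \<eta> g. mult S = m}"
  have neg: "(\<Sum>i=1..<m. - u i * (real (kunz S i) - \<mu>)) = - (\<Sum>i=1..<m. u i * (real (kunz S i) - \<mu>))"
    for u :: "nat \<Rightarrow> real" and S by (simp add: sum_negf)
  have "?A \<subseteq> ?S (deep \<epsilon>) \<union> (?dev (\<lambda>_. 1) \<union> ?dev (\<lambda>_. - 1)) \<union> (?dev ?u \<union> ?dev (\<lambda>i. - ?u i))"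
  proof
    fix S assume S: "S \<in> ?A"
    then have Sg: "S \<in> semigroups_of_genus g" "mult S = m" by (auto simp: atypical_def)
    show "S \<in> ?S (deep \<epsilon>) \<union> (?dev (\<lambda>_. 1) \<union> ?dev (\<lambda>_. - 1)) \<union> (?dev ?u \<union> ?dev (\<lambda>i. - ?u i))"
    proof (rule ccontr)
      assume not: "\<not> ?thesis"
      then have nd: "\<not> deep \<epsilon> S" using Sg by blast
      have dev: "(\<Sum>i=1..<m. u i * (real (kunz S i) - \<mu>)) \<le> \<eta> * real m" if "S \<notin> ?dev u" for u
        using that Sg nd by (auto simp: not_less)
      have "\<bar>\<Sum>i=1..<m. real (kunz S i) - \<mu>\<bar> \<le> \<eta> * real m"
      proof -
        have "S \<notin> ?dev (\<lambda>_. 1)" "S \<notin> ?dev (\<lambda>_. - 1)" using not by blast+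
        from this[THEN dev] have "(\<Sum>i=1..<m. 1 * (real (kunz S i) - \<mu>)) \<le> \<eta> * real m"
          "- (\<Sum>i=1..<m. 1 * (real (kunz S i) - \<mu>)) \<le> \<eta> * real m"
          unfolding neg by blast+
        then show ?thesis by (simp add: abs_le_iff)
      qed
      moreover have "\<bar>\<Sum>i=1..<m. ?u i * (real (kunz S i) - \<mu>)\<bar> \<le> \<eta> * real m"
      proof -
        have "S \<notin> ?dev ?u" "S \<notin> ?dev (\<lambda>i. - ?u i)" using not by blast+
        from this[THEN dev] show ?thesis unfolding neg abs_le_iff by blast
      qed
      ultimately have "\<bar>weight S - \<xi> / 10 * (real g)\<^sup>2\<bar> \<le> 24 * \<eta> * (real g)\<^sup>2 + 40 * real g"
        using weight_estimate[OF Sg nd \<epsilon>(1,2) \<eta>(2) g] by blast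
      then show False using S by (simp add: atypical_def)
    qed
  qed
  then have "card ?A \<le> card (?S (deep \<epsilon>) \<union> (?dev (\<lambda>_. 1) \<union> ?dev (\<lambda>_. - 1)) \<union> (?dev ?u \<union> ?dev (\<lambda>i. - ?u i)))"
    by (intro card_mono finite_subset[OF _ finite_semigroups_of_genus[of g]]) auto
  also have "\<dots> \<le> card (?S (deep \<epsilon>)) + (card (?dev (\<lambda>_. 1)) + card (?dev (\<lambda>_. - 1)))
      + (card (?dev ?u) + card (?dev (\<lambda>i. - ?u i)))"
    by (intro order_trans[OF card_Un_le] add_mono order_refl)
  finally have "real (card ?A) \<le> real (card (?S (deep \<epsilon>))) + (real (card (?dev (\<lambda>_. 1))) + real (card (?dev (\<lambda>_. - 1))))
      + (real (card (?dev ?u)) + real (card (?dev (\<lambda>i. - ?u i))))"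
    by linarith
  then have "real (card ?A) * \<xi> ^ g \<le> (real (card (?S (deep \<epsilon>))) + (real (card (?dev (\<lambda>_. 1))) + real (card (?dev (\<lambda>_. - 1))))
      + (real (card (?dev ?u)) + real (card (?dev (\<lambda>i. - ?u i))))) * \<xi> ^ g"
    by (intro mult_right_mono) auto
  also have "\<dots> \<le> 4 * (real g + 1) ^ 5 * rate powr (\<eta>\<^sup>2 * real g / 640) + 4 * exp (- (\<eta>\<^sup>2 * real g / 160))"
  proof -
    have D: "real (card (?S (deep \<epsilon>))) * \<xi> ^ g \<le> 4 * (real g + 1) ^ 5 * rate powr (\<eta>\<^sup>2 * real g / 640)"
    proof -
      have "\<eta>\<^sup>2 * real g \<le> \<eta>\<^sup>2 * (20 * real m)" using m by (intro mult_left_mono) auto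
      then have "\<eta>\<^sup>2 * real g / 640 \<le> \<eta>\<^sup>2 * (20 * real m) / 640" by (rule divide_right_mono) simp
      also have "\<dots> = \<epsilon> * real m / 2" by (simp add: \<epsilon>_def)
      finally have "rate powr (\<epsilon> * real m / 2) \<le> rate powr (\<eta>\<^sup>2 * real g / 640)"
        using rate_le_1 by (intro powr_mono') auto
      then have "4 * (real g + 1) ^ 5 * rate powr (\<epsilon> * real m / 2) \<le> 4 * (real g + 1) ^ 5 * rate powr (\<eta>\<^sup>2 * real g / 640)"
        by (intro mult_left_mono) auto
      then show ?thesis using card_deep_le[OF \<epsilon>(1,3) m(1)] by linarith
    qed
    have E: "real (card (?dev u)) * \<xi> ^ g \<le> exp (- (\<eta>\<^sup>2 * real g / 160))"
      if "\<And>i. i < m \<Longrightarrow> \<bar>u i\<bar> \<le> 1" for u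
    proof -
      have "\<eta>\<^sup>2 * real g \<le> \<eta>\<^sup>2 * (20 * real m)" using m by (intro mult_left_mono) auto
      then have "\<eta>\<^sup>2 * real g / 160 \<le> \<eta>\<^sup>2 * (20 * real m) / 160" by (rule divide_right_mono) simp
      also have "\<dots> = \<eta>\<^sup>2 * real m / 8" by simp
      finally have "exp (- (\<eta>\<^sup>2 * real m / 8)) \<le> exp (- (\<eta>\<^sup>2 * real g / 160))"
        by (simp only: exp_le_cancel_iff neg_le_iff_le)
      then show ?thesis using card_deviating_le[where m = m and u = u and g = g, OF that \<eta>] unfolding \<epsilon>_def by linarith
    qed
    have "\<bar>real i / real m\<bar> \<le> 1" if "i < m" for i using that by simp
    then show ?thesis
      using D E[of "\<lambda>_. 1"] E[of "\<lambda>_. - 1"] E[of ?u] E[of "\<lambda>i. - ?u i"]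
      unfolding distrib_right by simp
  qed
  finally show ?thesis .
qed

lemma card_atypical_le:
  assumes \<eta>: "0 < \<eta>" "\<eta> \<le> 1" and g: "1 \<le> g"
  shows "real (card (atypical \<eta> g)) * \<xi> ^ g \<le> (real g + 2) *
    ((97 / 100) ^ g + 4 * (real g + 1) ^ 5 * rate powr (\<eta>\<^sup>2 * real g / 640) + 4 * exp (- (\<eta>\<^sup>2 * real g / 160)))"
    (is "_ \<le> _ * ?b")
proof -
  let ?A = "\<lambda>m. {S \<in> atypical \<eta> g. mult S = m}"
  have one: "real (card (?A m)) * \<xi> ^ g \<le> ?b" if "m \<le> g + 1" for m
  proof (cases "20 * m \<le> g")
    case True
    have "real (card (?A m)) \<le> real (card {S \<in> semigroups_of_genus g. mult S = m})"
      unfolding of_nat_le_iff by (intro card_mono finite_subset[OF _ finite_semigroups_of_genus[of g]])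
        (auto simp: atypical_def)
    then have "real (card (?A m)) * \<xi> ^ g \<le> real (card {S \<in> semigroups_of_genus g. mult S = m}) * \<xi> ^ g"
      by (intro mult_right_mono) auto
    also have "\<dots> \<le> (97 / 100) ^ g" by (rule card_small_mult_le[OF True])
    finally have "real (card (?A m)) * \<xi> ^ g \<le> (97 / 100) ^ g" .
    moreover have "0 \<le> 4 * (real g + 1) ^ 5 * rate powr (\<eta>\<^sup>2 * real g / 640)"
      "0 \<le> 4 * exp (- (\<eta>\<^sup>2 * real g / 160))" by simp_all
    ultimately show ?thesis by linarith
  next
    case False
    have "real (card (?A m)) * \<xi> ^ g \<le>
      4 * (real g + 1) ^ 5 * rate powr (\<eta>\<^sup>2 * real g / 640) + 4 * exp (- (\<eta>\<^sup>2 * real g / 160))"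
      using False by (intro card_atypical_mult_le[OF \<eta> that _ g]) simp
    moreover have "0 \<le> (97 / 100 :: real) ^ g" by simp
    ultimately show ?thesis by linarith
  qed
  have "atypical \<eta> g \<subseteq> (\<Union>m\<le>g + 1. ?A m)"
    using mult_le_genus by (fastforce simp: atypical_def semigroups_of_genus_def)
  moreover have fin: "finite (?A m)" for m
    by (rule finite_subset[OF _ finite_semigroups_of_genus[of g]]) (auto simp: atypical_def)
  ultimately have "card (atypical \<eta> g) \<le> card (\<Union>m\<le>g + 1. ?A m)"
    by (intro card_mono) auto
  also have "\<dots> \<le> (\<Sum>m\<le>g + 1. card (?A m))" by (intro card_UN_le) simp
  finally have "real (card (atypical \<eta> g)) \<le> (\<Sum>m\<le>g + 1. real (card (?A m)))"
    by (simp flip: of_nat_sum)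
  then have "real (card (atypical \<eta> g)) * \<xi> ^ g \<le> (\<Sum>m\<le>g + 1. real (card (?A m))) * \<xi> ^ g"
    by (intro mult_right_mono) auto
  also have "\<dots> = (\<Sum>m\<le>g + 1. real (card (?A m)) * \<xi> ^ g)" by (rule sum_distrib_right)
  also have "\<dots> \<le> (\<Sum>m\<le>g + 1. ?b)" using one by (intro sum_mono) auto
  also have "\<dots> = (real g + 2) * ?b" by simp
  finally show ?thesis .
qed

text \<open>As \<open>\<xi> ^ g\<close> times the number of semigroups is at least \<xi>, the
  weighted count of atypical ones, divided by \<xi>, bounds their proportion; exponential decay
  beats the polynomial factors.\<close>

lemma atypical_proportion_tendsto_0:
  assumes \<eta>: "0 < \<eta>" "\<eta> \<le> 1"
  shows "(\<lambda>g. real (card (atypical \<eta> g)) / real (card (semigroups_of_genus g))) \<longlonglongrightarrow> 0"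
proof (rule tendsto_sandwich[OF _ _ tendsto_const])
  let ?b = "\<lambda>g. (real g + 2) *
    ((97 / 100) ^ g + 4 * (real g + 1) ^ 5 * rate powr (\<eta>\<^sup>2 * real g / 640) + 4 * exp (- (\<eta>\<^sup>2 * real g / 160))) / \<xi>"
  show "\<forall>\<^sub>F g in sequentially. real (card (atypical \<eta> g)) / real (card (semigroups_of_genus g)) \<le> ?b g"
    using eventually_ge_at_top[of 1]
  proof eventually_elim
    case (elim g)
    let ?N = "real (card (semigroups_of_genus g))"
    have N: "\<xi> \<le> ?N * \<xi> ^ g" by (rule card_semigroups_lower_bound)
    have "0 < ?N * \<xi> ^ g" using N \<xi>_pos by linarith
    moreover have "\<xi> \<noteq> 0" using \<xi>_pos by linarith
    ultimately have "real (card (atypical \<eta> g)) / ?N = real (card (atypical \<eta> g)) * \<xi> ^ g / (?N * \<xi> ^ g)"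
      by simp
    also have "\<dots> \<le> real (card (atypical \<eta> g)) * \<xi> ^ g / \<xi>"
      using N \<open>0 < ?N * \<xi> ^ g\<close> by (intro divide_left_mono) auto
    also have "\<dots> \<le> ?b g"
      by (intro divide_right_mono card_atypical_le[OF \<eta> elim]) simp
    finally show ?case .
  qed
  \<comment> \<open>Positive decay rates put all terms into the form \<open>exp (- (a * g))\<close>,
    whose limits are computed directly.\<close>
  define a b where "a = - ln rate * (\<eta>\<^sup>2 / 640)" and "b = \<eta>\<^sup>2 / 160"
  have "ln rate < 0" by (simp add: rate_def)
  then have ab: "0 < a" "0 < b" using \<eta> by (auto simp: a_def b_def mult_neg_pos)
  have "(\<lambda>g. (real g + 2) * (97 / 100) ^ g) \<longlonglongrightarrow> 0" by real_asymp
  moreover have "(\<lambda>g. 4 * (real g + 2) * (real g + 1) ^ 5 * exp (- (a * real g))) \<longlonglongrightarrow> 0"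
    using ab(1) by real_asymp
  moreover have "(\<lambda>g. 4 * (real g + 2) * exp (- (b * real g))) \<longlonglongrightarrow> 0"
    using ab(2) by real_asymp
  ultimately have "(\<lambda>g. (real g + 2) * (97 / 100) ^ g + (4 * (real g + 2) * (real g + 1) ^ 5 * exp (- (a * real g))
      + 4 * (real g + 2) * exp (- (b * real g)))) \<longlonglongrightarrow> 0"
    by (intro tendsto_add_zero)
  also have "(\<lambda>g. (real g + 2) * (97 / 100) ^ g + (4 * (real g + 2) * (real g + 1) ^ 5 * exp (- (a * real g))
      + 4 * (real g + 2) * exp (- (b * real g)))) =
    (\<lambda>g. (real g + 2) * ((97 / 100) ^ g + 4 * (real g + 1) ^ 5 * exp (- (a * real g)) + 4 * exp (- (b * real g))))"
    by (rule ext) (simp add: algebra_simps)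
  finally have "(\<lambda>g. (real g + 2) * ((97 / 100) ^ g + 4 * (real g + 1) ^ 5 * exp (- (a * real g))
      + 4 * exp (- (b * real g)))) \<longlonglongrightarrow> 0" .
  moreover have eqs: "rate powr (\<eta>\<^sup>2 * real g / 640) = exp (- (a * real g))"
    "\<eta>\<^sup>2 * real g / 160 = b * real g" for g
    by (simp_all add: powr_def a_def b_def less_imp_neq[OF rate_pos, symmetric])
  ultimately show "?b \<longlonglongrightarrow> 0" unfolding eqs by (intro tendsto_divide_zero)
qed auto

section \<open>From concentration to the second moment\<close>

lemma golden_ratio_\<xi>: "1 / (10 * golden_ratio) = \<xi> / 10"
proof -
  have "\<xi> * golden_ratio = 1" by (simp add: \<xi>_def golden_ratio_def field_simps)
  then have "\<xi> = 1 / golden_ratio" by (metis mult_not_zero nonzero_eq_divide_eq zero_neq_one)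
  then show ?thesis by simp
qed

text \<open>For \<open>v = weight S / g ^ 2\<close> the difference of squares factors, and
  \<open>abs_weight_le\<close> bounds the second factor by \<open>5 / 2\<close>. In the atypical
  case the first is at most \<open>12 / 5\<close>, which gives 6.\<close>

lemma square_deviation_le:
  assumes S: "S \<in> semigroups_of_genus g" and g: "1 \<le> g" and \<eta>: "0 \<le> \<eta>"
  shows "\<bar>(weight S)\<^sup>2 / (real g) ^ 4 - (\<xi> / 10)\<^sup>2\<bar> \<le>
    3 * (24 * \<eta> + 40 / real g) + (if S \<in> atypical \<eta> g then 6 else 0)"
proof -
  define v where "v = weight S / (real g)\<^sup>2"
  have v: "\<bar>v\<bar> \<le> 2"
    using abs_weight_le[OF S] g by (simp add: v_def abs_divide divide_le_eq)
  have "(weight S)\<^sup>2 / (real g) ^ 4 - (\<xi> / 10)\<^sup>2 = (v - \<xi> / 10) * (v + \<xi> / 10)"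
    by (simp add: v_def power_divide square_diff_square_factored flip: power_mult)
       (simp add: algebra_simps power2_eq_square eval_nat_numeral)
  then have "\<bar>(weight S)\<^sup>2 / (real g) ^ 4 - (\<xi> / 10)\<^sup>2\<bar> = \<bar>v - \<xi> / 10\<bar> * \<bar>v + \<xi> / 10\<bar>"
    by (simp add: abs_mult)
  also have "\<dots> \<le> \<bar>v - \<xi> / 10\<bar> * (5 / 2)"
  proof (rule mult_left_mono)
    show "\<bar>v + \<xi> / 10\<bar> \<le> 5 / 2" using v \<xi>_bounds by linarith
  qed simp
  finally have le: "\<bar>(weight S)\<^sup>2 / (real g) ^ 4 - (\<xi> / 10)\<^sup>2\<bar> \<le> \<bar>v - \<xi> / 10\<bar> * (5 / 2)" .
  show ?thesis
  proof (cases "S \<in> atypical \<eta> g")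
    case True
    have "\<bar>v - \<xi> / 10\<bar> \<le> 12 / 5" using v \<xi>_bounds by linarith
    moreover have "0 \<le> 3 * (24 * \<eta> + 40 / real g)" using \<eta> by simp
    ultimately show ?thesis using le True by simp
  next
    case False
    have "\<bar>v - \<xi> / 10\<bar> = \<bar>weight S - \<xi> / 10 * (real g)\<^sup>2\<bar> / (real g)\<^sup>2"
    proof -
      have "v - \<xi> / 10 = (weight S - \<xi> / 10 * (real g)\<^sup>2) / (real g)\<^sup>2"
        using g by (simp add: v_def diff_divide_distrib)
      then show ?thesis by simp
    qed
    also have "\<dots> \<le> (24 * \<eta> * (real g)\<^sup>2 + 40 * real g) / (real g)\<^sup>2"
      using False S by (intro divide_right_mono) (auto simp: atypical_def not_less)
    also have "\<dots> = 24 * \<eta> + 40 / real g"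
      using g by (simp add: add_divide_distrib power2_eq_square)
    finally have "\<bar>v - \<xi> / 10\<bar> \<le> 24 * \<eta> + 40 / real g" .
    then have "3 * \<bar>v - \<xi> / 10\<bar> \<le> 3 * (24 * \<eta> + 40 / real g)" by (intro mult_left_mono) auto
    then have "\<bar>(weight S)\<^sup>2 / (real g) ^ 4 - (\<xi> / 10)\<^sup>2\<bar> \<le> 3 * (24 * \<eta> + 40 / real g)"
      using le by linarith
    then show ?thesis using False by simp
  qed
qed

lemma expectation_deviation_le:
  assumes g: "1 \<le> g" and \<eta>: "0 \<le> \<eta>"
  shows "\<bar>expect_g g (\<lambda>S. (weight S)\<^sup>2) / (real g) ^ 4 - (\<xi> / 10)\<^sup>2\<bar> \<le>
    3 * (24 * \<eta> + 40 / real g) + 6 * (real (card (atypical \<eta> g)) / real (card (semigroups_of_genus g)))"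
proof -
  let ?X = "semigroups_of_genus g"
  let ?N = "real (card ?X)"
  have N: "0 < ?N" using card_semigroups_lower_bound[of g] \<xi>_pos by (cases "card ?X = 0") auto
  have "expect_g g (\<lambda>S. (weight S)\<^sup>2) / (real g) ^ 4 - (\<xi> / 10)\<^sup>2 =
      (\<Sum>S\<in>?X. (weight S)\<^sup>2 / (real g) ^ 4 - (\<xi> / 10)\<^sup>2) / ?N"
    using N unfolding expect_g_def sum_subtractf sum_divide_distrib[symmetric] by (simp add: diff_divide_distrib mult.commute)
  then have "\<bar>expect_g g (\<lambda>S. (weight S)\<^sup>2) / (real g) ^ 4 - (\<xi> / 10)\<^sup>2\<bar> =
      \<bar>\<Sum>S\<in>?X. (weight S)\<^sup>2 / (real g) ^ 4 - (\<xi> / 10)\<^sup>2\<bar> / ?N" by simp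
  also have "\<dots> \<le> (\<Sum>S\<in>?X. 3 * (24 * \<eta> + 40 / real g) + (if S \<in> atypical \<eta> g then 6 else 0)) / ?N"
    using square_deviation_le[OF _ g \<eta>]
    by (intro divide_right_mono order_trans[OF sum_abs] sum_mono) auto
  also have "(\<Sum>S\<in>?X. 3 * (24 * \<eta> + 40 / real g) + (if S \<in> atypical \<eta> g then 6 else 0)) =
      ?N * (3 * (24 * \<eta> + 40 / real g)) + 6 * real (card (atypical \<eta> g))"
  proof -
    have "{S \<in> ?X. S \<in> atypical \<eta> g} = atypical \<eta> g" by (auto simp: atypical_def)
    then have "(\<Sum>S\<in>?X. if S \<in> atypical \<eta> g then 6 else 0) = 6 * real (card (atypical \<eta> g))"
      using finite_semigroups_of_genus[of g] by (simp flip: sum.inter_filter)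
    then show ?thesis by (simp add: sum.distrib)
  qed
  also have "(?N * (3 * (24 * \<eta> + 40 / real g)) + 6 * real (card (atypical \<eta> g))) / ?N =
      3 * (24 * \<eta> + 40 / real g) + 6 * (real (card (atypical \<eta> g)) / ?N)"
    using N by (simp add: add_divide_distrib)
  finally show ?thesis .
qed

theorem theorem7p1:
  shows "(\<lambda>g. expect_g g (\<lambda>S. (weight S)^2) / (real g)^4)
           \<longlonglongrightarrow> (1 / (10 * golden_ratio))^2"
  unfolding golden_ratio_\<xi>
proof (rule tendstoI)
  fix e :: real assume e: "0 < e"
  \<comment> \<open>Each of the three errors \<open>72 * \<eta>\<close>, \<open>120 / g\<close> and
    6 times the atypical proportion gets a share \<open>e / 3\<close>.\<close>
  define \<eta> where "\<eta> = min 1 (e / 216)"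
  have \<eta>: "0 < \<eta>" "\<eta> \<le> 1" "72 * \<eta> \<le> e / 3" using e by (auto simp: \<eta>_def)
  have "(\<lambda>g. 40 / real g) \<longlonglongrightarrow> 0" by real_asymp
  then have "\<forall>\<^sub>F g in sequentially. 40 / real g < e / 9"
    using e by (auto dest: order_tendstoD(2)[where a = "e / 9"])
  moreover have "\<forall>\<^sub>F g in sequentially. real (card (atypical \<eta> g)) / real (card (semigroups_of_genus g)) < e / 18"
    using order_tendstoD(2)[OF atypical_proportion_tendsto_0[OF \<eta>(1,2)], of "e / 18"] e by simp
  ultimately show "\<forall>\<^sub>F g in sequentially.
      dist (expect_g g (\<lambda>S. (weight S)\<^sup>2) / real g ^ 4) ((\<xi> / 10)\<^sup>2) < e"
    using eventually_ge_at_top[of 1]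
  proof eventually_elim
    case (elim g)
    have "x < e" if "x \<le> 3 * (24 * \<eta> + y) + 6 * z" "y < e / 9" "z < e / 18" for x y z :: real
      using that \<eta>(3) unfolding distrib_left by linarith
    from this[OF expectation_deviation_le[OF elim(3) less_imp_le[OF \<eta>(1)]] elim(1,2)]
    show ?case unfolding dist_real_def .
  qed
qed

end
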